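(* Let $n,r\ge1$ and let $\boldsymbol\lambda=(\lambda_1\ge\dots\ge\lambda_r\ge0)$ be a partition of length at most $r$. Then $$\Big(\sum_{i,j\ge0}X^i(c)z^i\otimes\partial^j(s)w^{-j}\Big)\star\Delta_{\boldsymbol\lambda}(H_r(c))=\frac{z^{r-1}}{w^{r-1}}\,\frac{\mathbf c(z)}{\mathbf c(w)}\,\frac1{E_r(z)}\,\Delta_{\boldsymbol\lambda}(\mathbf w^{-1}(c),\overline\sigma_-(z)H_r(c)).$$
   Context: **Rings.** Let $B_0(c)=\mathbb Q[c_1,\dots,c_n]$, $c_0=1$, $c_i=0$ for $i>n$, $\mathbf c(z)=1-c_1z+\cdots+(-1)^nc_nz^n$, and $\mathbf s(w)=\sum_{i\ge0}s_iw^i=\frac1{\mathbf c(w)}$. Let $V(c)=B_0(c)[X]$ and $X^j(c)=\sum_{i=0}^{j}(-1)^ic_iX^{j-i}$ for $j\ge0$; these form a $B_0(c)$-basis of $V(c)$. Let $\partial^j$ be the linear form on $V(c)$ with $\partial^j(X^i)=\delta_{ij}$, and put $\boldsymbol\partial(w^{-1})=\sum_{j\ge0}\partial^jw^{-j}$. The linear forms $(\partial^j(s))_{j\ge0}$ are introduced through the equality $$\sum_{j\ge0}\partial^j(s)w^{-j}=\mathbf s(w)\,\boldsymbol\partial(w^{-1})=\frac{\boldsymbol\partial(w^{-1})}{\mathbf c(w)},$$ and they are the dual basis of $(X^i(c))_{i\ge0}$, i.e. $\partial^j(s)(X^i(c))=\delta_{ij}$. Let $B_r(c)=B_0(c)[e_1,\dots,e_r]$,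 $E_r(z)=1-e_1z+\cdots+(-1)^re_rz^r$, $\sum_{j}h_jz^j=1/E_r(z)$, and $\sum_{j\in\mathbb Z}h_j(c)z^j=\mathbf c(z)/E_r(z)\in B_r(c)[[z]]$ (so $h_j(c)=0$ for $j<0$). For a partition $\boldsymbol\lambda$ of length at most $r$ let $\Delta_{\boldsymbol\lambda}(H_r(c))=\det\big(h_{\lambda_j-j+k}(c)\big)_{1\le k,j\le r}$ ($k$ = row, $j$ = column). **Module structure.** Write $[\mathbf X(c)]^r_{\boldsymbol\lambda}=X^{r-1+\lambda_1}(c)\wedge X^{r-2+\lambda_2}(c)\wedge\cdots\wedge X^{\lambda_r}(c)\in\bigwedge^rV(c)$ and $[\mathbf X(c)]^r_0=X^{r-1}(c)\wedge\cdots\wedge X^0(c)$ (exterior power over $B_0(c)$). $\bigwedge^rV(c)$ is a $B_r(c)$-module in which $h_i$ acts as $\sigma_i$, where $\sigma_i(v_1\wedge\cdots\wedge v_r)=\sum_{a_1+\cdots+a_r=i,\ a_k\ge0}X^{a_1}v_1\wedge\cdots\wedge X^{a_r}v_r$; it is free of rank one generated by $[\mathbf X(c)]^r_0$, and $\Delta_{\boldsymbol\lambda}(H_r(c))\,[\mathbf X(c)]^r_0=[\mathbf X(c)]^r_{\boldsymbol\lambda}$. **The action $\star$.** For a linear form $\partial$ on $V(c)$, $\partial\lrcorner(u_1\wedge\cdots\wedge u_r)=\sum_{k=1}^r(-1)^{k-1}\partial(u_k)\,u_1\wedge\cdots\wedge\widehat{u_k}\wedge\cdots\wedge u_r$. For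 $f\in V(c)$, $(f\otimes\partial)\star\Delta_{\boldsymbol\lambda}(H_r(c))$ is the unique element of $B_r(c)$ with $$\big[(f\otimes\partial)\star\Delta_{\boldsymbol\lambda}(H_r(c))\big][\mathbf X(c)]^r_0=f\wedge\big(\partial\lrcorner[\mathbf X(c)]^r_{\boldsymbol\lambda}\big),$$ extended coefficientwise to generating functions. **The determinant.** For $m\ge0$ let $w^{-m}(c)$ be the value of the polynomial $X^m(c)$ at $X=w^{-1}$, i.e. $w^{-m}(c)=\sum_{i=0}^m(-1)^ic_iw^{-m+i}$. Put $\overline\sigma_-(z)h_j(c)=h_j(c)-h_{j-1}(c)z^{-1}$. Then $\Delta_{\boldsymbol\lambda}(\mathbf w^{-1}(c),\overline\sigma_-(z)H_r(c))$ is $w^{r-1}$ times the determinant of the $r\times r$ matrix whose first row is $\big(w^{-r+1-\lambda_1}(c),\,w^{-r+2-\lambda_2}(c),\dots,w^{-\lambda_r}(c)\big)$ and whose $(k,j)$ entry, for $2\le k\le r$ and $1\le j\le r$, is $\overline\sigma_-(z)h_{\lambda_j-j+k}(c)$.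
   Formalization: The sum over j runs over all integers, with ∂^j(s) the coefficient of w^{-j} in s(w)∂(w^{-1}); restricted to j≥0 the equality fails (n=r=1, λ=(0): left side c(z)/E_1(z), right side c(z)/(c(w)E_1(z))). *)

theory Defs
  imports
    "HOL-Library.Cardinality"
    "HOL-Library.Poly_Mapping"
    "HOL-Computational_Algebra.Formal_Laurent_Series"
    "Jordan_Normal_Form.Determinant"
begin

hide_const (open) Poly_Mapping.degree Poly_Mapping.nth Poly_Mapping.range
hide_const (open) Module.smult

text \<open>
  The exterior algebra of \<open>K[X]\<close> over a commutative ring \<open>K\<close>: the tensor algebra is the free
  \<open>K\<close>-module on all words in \<open>K[X]\<close> modulo multilinearity, and dividing also by the words with two
  equal neighbours gives the exterior algebra.  Its degree \<open>r\<close> part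
  \<open>\<Lambda>\<^sup>r K[X]\<close> is spanned by the images of the words of length \<open>r\<close>.
\<close>

definition fscale :: "'k::comm_ring_1 \<Rightarrow> ('a \<Rightarrow>\<^sub>0 'k) \<Rightarrow> ('a \<Rightarrow>\<^sub>0 'k)" where
  "fscale a p = Poly_Mapping.map ((*) a) p"

definition word :: "'k::comm_ring_1 poly list \<Rightarrow> ('k poly list \<Rightarrow>\<^sub>0 'k)" where
  "word us = Poly_Mapping.single us 1"

definition ext_gens :: "('k::comm_ring_1 poly list \<Rightarrow>\<^sub>0 'k) set" where
  "ext_gens =
     {word (us @ (u + v) # vs) - word (us @ u # vs) - word (us @ v # vs) | us u v vs. True} \<union>
     {word (us @ smult a u # vs) - fscale a (word (us @ u # vs)) | us a u vs. True} \<union>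
     {word (us @ u # u # vs) | us u vs. True}"

definition ext_rel ::
  "('k::comm_ring_1 poly list \<Rightarrow>\<^sub>0 'k) \<Rightarrow> ('k poly list \<Rightarrow>\<^sub>0 'k) \<Rightarrow> bool" where
  "ext_rel p q \<longleftrightarrow> p - q \<in> Modules.module.span fscale ext_gens"

lemma lookup_fscale [simp]: "Poly_Mapping.lookup (fscale a p) k = a * Poly_Mapping.lookup p k"
  by (simp add: fscale_def map.rep_eq when_def)

interpretation free: Modules.module fscale
  by standard (auto intro!: poly_mapping_eqI simp: lookup_add algebra_simps)

lemma ext_rel_equivp: "equivp (ext_rel :: ('k::comm_ring_1 poly list \<Rightarrow>\<^sub>0 'k) \<Rightarrow> _)"
proof (rule equivpI)
  show "reflp (ext_rel :: ('k poly list \<Rightarrow>\<^sub>0 'k) \<Rightarrow> _)"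
    by (auto intro!: reflpI simp: ext_rel_def free.span_zero)
  show "symp (ext_rel :: ('k poly list \<Rightarrow>\<^sub>0 'k) \<Rightarrow> _)"
    by (rule sympI) (metis ext_rel_def free.span_neg minus_diff_eq)
  show "transp (ext_rel :: ('k poly list \<Rightarrow>\<^sub>0 'k) \<Rightarrow> _)"
  proof (rule transpI)
    fix p q s :: "'k poly list \<Rightarrow>\<^sub>0 'k"
    assume "ext_rel p q" "ext_rel q s"
    then have "(p - q) + (q - s) \<in> free.span ext_gens"
      unfolding ext_rel_def by (rule free.span_add)
    then show "ext_rel p s" by (simp add: ext_rel_def)
  qed
qed

quotient_type (overloaded) 'k ext = "'k::comm_ring_1 poly list \<Rightarrow>\<^sub>0 'k" / ext_rel
  by (rule ext_rel_equivp)

instantiation ext :: (comm_ring_1) ab_group_add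
begin

lift_definition zero_ext :: "'a ext" is 0 .

lift_definition plus_ext :: "'a ext \<Rightarrow> 'a ext \<Rightarrow> 'a ext" is "(+)"
  unfolding ext_rel_def by (metis add_diff_add free.span_add)

lift_definition uminus_ext :: "'a ext \<Rightarrow> 'a ext" is uminus
  unfolding ext_rel_def by (metis free.span_neg minus_diff_minus)

lift_definition minus_ext :: "'a ext \<Rightarrow> 'a ext \<Rightarrow> 'a ext" is "(-)"
proof -
  fix a b c d :: "'a poly list \<Rightarrow>\<^sub>0 'a"
  assume "ext_rel a b" "ext_rel c d"
  then have "(a - b) - (c - d) \<in> free.span ext_gens"
    unfolding ext_rel_def by (rule free.span_diff)
  then show "ext_rel (a - c) (b - d)"
    by (simp add: ext_rel_def algebra_simps)
qed

instance
  by standard (transfer, simp add: ext_rel_def free.span_zero add.assoc add.commute)+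

end

lift_definition ext_scale :: "'k::comm_ring_1 \<Rightarrow> 'k ext \<Rightarrow> 'k ext" is fscale
  unfolding ext_rel_def by (metis free.scale_right_diff_distrib free.span_scale)

lift_definition wedge :: "'k::comm_ring_1 poly list \<Rightarrow> 'k ext" is word .

interpretation ext: Modules.module ext_scale
  by standard (transfer, simp add: ext_rel_def free.span_zero algebra_simps)+

interpretation ext_pair: module_pair ext_scale ext_scale ..

text \<open>The linear map exists for every alternating multilinear \<open>g\<close>, by \<open>ext_universal\<close> below.\<close>

definition ext_lift :: "('k::comm_ring_1 poly list \<Rightarrow> 'k ext) \<Rightarrow> 'k ext \<Rightarrow> 'k ext" where
  "ext_lift g = (THE F. module_hom ext_scale ext_scale F \<and> (\<forall>us. F (wedge us) = g us))"

definition wedge_left :: "'k::comm_ring_1 poly \<Rightarrow> 'k ext \<Rightarrow> 'k ext" where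
  "wedge_left f = ext_lift (\<lambda>us. wedge (f # us))"

definition contract :: "('k::comm_ring_1 poly \<Rightarrow> 'k) \<Rightarrow> 'k ext \<Rightarrow> 'k ext" where
  "contract \<phi> = ext_lift (\<lambda>us. \<Sum>k<length us.
     ext_scale ((-1) ^ k * \<phi> (us ! k)) (wedge (take k us @ drop (Suc k) us)))"

definition sigma :: "nat \<Rightarrow> 'k::comm_ring_1 ext \<Rightarrow> 'k ext" where
  "sigma i = ext_lift (\<lambda>us. \<Sum>as | length as = length us \<and> sum_list as = i.
     wedge (map2 (\<lambda>a u. monom 1 a * u) as us))"

definition alt_multilin ::
  "('k::comm_ring_1 \<Rightarrow> 'b::ab_group_add \<Rightarrow> 'b) \<Rightarrow> ('k poly list \<Rightarrow> 'b) \<Rightarrow> bool" where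
  "alt_multilin s g \<longleftrightarrow>
     (\<forall>us u v vs. g (us @ (u + v) # vs) = g (us @ u # vs) + g (us @ v # vs)) \<and>
     (\<forall>us a u vs. g (us @ smult a u # vs) = s a (g (us @ u # vs))) \<and>
     (\<forall>us u vs. g (us @ u # u # vs) = 0)"

lemma ext_relI: "p - q \<in> ext_gens \<Longrightarrow> ext_rel p q"
  unfolding ext_rel_def by (rule free.span_base)

lemma wedge_alt_multilin: "alt_multilin ext_scale wedge"
  unfolding alt_multilin_def
proof (intro conjI allI)
  fix us vs :: "'a poly list" and u v a
  show "wedge (us @ (u + v) # vs) = wedge (us @ u # vs) + wedge (us @ v # vs)"
    by transfer (rule ext_relI, unfold ext_gens_def diff_diff_eq[symmetric], blast)
  show "wedge (us @ smult a u # vs) = ext_scale a (wedge (us @ u # vs))"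
    by transfer (rule ext_relI, unfold ext_gens_def diff_zero, blast)
  show "wedge (us @ u # u # vs) = 0"
    by transfer (rule ext_relI, unfold ext_gens_def diff_zero, blast)
qed

lemma poly_mapping_expand: "p = (\<Sum>us\<in>Poly_Mapping.keys p. fscale (Poly_Mapping.lookup p us) (Poly_Mapping.single us 1))"
proof (rule poly_mapping_eqI)
  fix k
  have "(\<Sum>us\<in>Poly_Mapping.keys p. Poly_Mapping.lookup p us * (1 when us = k)) =
        (\<Sum>us\<in>Poly_Mapping.keys p. if us = k then Poly_Mapping.lookup p us else 0)"
    by (rule sum.cong) (auto simp: when_def)
  also have "\<dots> = Poly_Mapping.lookup p k"
    by (simp add: in_keys_iff)
  finally show "Poly_Mapping.lookup p k = Poly_Mapping.lookup (\<Sum>us\<in>Poly_Mapping.keys p. fscale (Poly_Mapping.lookup p us) (Poly_Mapping.single us 1)) k"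
    by (simp add: lookup_sum lookup_single)
qed

lemma abs_ext_hom: "module_hom fscale ext_scale abs_ext"
  by unfold_locales (auto simp: plus_ext.abs_eq ext_scale.abs_eq)

lemma abs_ext_wedge: "abs_ext (Poly_Mapping.single us 1) = wedge us"
  by (simp add: wedge.abs_eq word_def)

lemma ext_expand: "\<exists>p. x = (\<Sum>us\<in>Poly_Mapping.keys p. ext_scale (Poly_Mapping.lookup p us) (wedge us))"
proof -
  obtain p where p: "x = abs_ext p" by (induct x rule: ext.abs_induct) auto
  interpret A: module_hom fscale ext_scale abs_ext by (rule abs_ext_hom)
  have "abs_ext p = (\<Sum>us\<in>Poly_Mapping.keys p. ext_scale (Poly_Mapping.lookup p us) (wedge us))"
    by (subst (1) poly_mapping_expand[of p]) (simp add: A.sum A.scale abs_ext_wedge)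
  then show ?thesis using p by blast
qed

lemma ext_hom_eqI:
  assumes "module_hom ext_scale s F" "module_hom ext_scale s G"
    and eq: "\<And>us. F (wedge us) = G (wedge us)"
  shows "F = (G :: 'a::comm_ring_1 ext \<Rightarrow> _)"
proof
  fix x :: "'a ext"
  interpret F: module_hom ext_scale s F by fact
  interpret G: module_hom ext_scale s G by fact
  obtain p where "x = (\<Sum>us\<in>Poly_Mapping.keys p. ext_scale (Poly_Mapping.lookup p us) (wedge us))"
    using ext_expand by blast
  then show "F x = G x" by (simp add: F.sum G.sum F.scale G.scale eq)
qed

theorem ext_universal:
  assumes "Modules.module s" and g: "alt_multilin s g"
  shows "\<exists>!F. module_hom ext_scale s F \<and> (\<forall>us. F (wedge us) = g us)"
proof -
  interpret M: Modules.module s by fact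
  define L where "L p = (\<Sum>us\<in>Poly_Mapping.keys p. s (Poly_Mapping.lookup p us) (g us))" for p
  have L_eq: "L p = (\<Sum>us\<in>A. s (Poly_Mapping.lookup p us) (g us))" if "Poly_Mapping.keys p \<subseteq> A" "finite A" for p A
    unfolding L_def by (rule sum.mono_neutral_left) (use that in \<open>auto simp: in_keys_iff\<close>)
  interpret L: module_hom fscale s L
  proof unfold_locales
    fix p q :: "'a poly list \<Rightarrow>\<^sub>0 'a" and a :: 'a
    let ?A = "Poly_Mapping.keys p \<union> Poly_Mapping.keys q"
    have "L (p + q) = (\<Sum>us\<in>?A. s (Poly_Mapping.lookup (p + q) us) (g us))"
      by (rule L_eq) (simp_all add: Poly_Mapping.keys_add)
    also have "\<dots> = L p + L q"
      by (simp add: L_eq[of p ?A] L_eq[of q ?A] lookup_add M.scale_left_distrib sum.distrib)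
    finally show "L (p + q) = L p + L q" .
    have "L (fscale a p) = (\<Sum>us\<in>Poly_Mapping.keys p. s (Poly_Mapping.lookup (fscale a p) us) (g us))"
      by (rule L_eq) (auto simp: in_keys_iff)
    also have "\<dots> = s a (L p)"
      by (simp add: L_def M.scale_sum_right)
    finally show "L (fscale a p) = s a (L p)" .
  qed
  have Lw: "L (word us) = g us" for us
    by (simp add: L_def word_def)
  have gens0: "L x = 0" if "x \<in> ext_gens" for x
    using that g unfolding ext_gens_def alt_multilin_def
    by (auto simp: L.diff L.scale Lw)
  have span0: "L x = 0" if "x \<in> free.span ext_gens" for x
    using that
  proof (induct rule: free.span_induct_alt)
    case base
    show ?case by (rule L.zero)
  next
    case (step c x y)
    then show ?case by (simp add: L.add L.scale gens0)
  qed
  have resp: "L p = L q" if "abs_ext p = abs_ext q" for p q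
  proof -
    have "p - q \<in> free.span ext_gens"
      using that by (simp add: ext.abs_eq_iff ext_rel_def)
    then show ?thesis using span0[of "p - q"] by (simp add: L.diff)
  qed
  define F where "F x = L (rep_ext x)" for x
  have abs_rep: "abs_ext (rep_ext x) = x" for x
    by (rule Quotient3_abs_rep[OF Quotient3_ext])
  have F: "F (abs_ext p) = L p" for p
    unfolding F_def by (rule resp) (rule abs_rep)
  have hom: "module_hom ext_scale s F"
  proof unfold_locales
    fix x y a
    show "F (x + y) = F x + F y"
      by (metis F L.add abs_rep plus_ext.abs_eq)
    show "F (ext_scale a x) = s a (F x)"
      by (metis F L.scale abs_rep ext_scale.abs_eq)
  qed
  have "F (wedge us) = g us" for us
    by (simp add: wedge.abs_eq F Lw)
  with hom show ?thesis
    by (intro ex1I[of _ F]) (auto intro: ext_hom_eqI)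
qed

lemma
  assumes "alt_multilin ext_scale g"
  shows ext_lift_hom: "module_hom ext_scale ext_scale (ext_lift g)"
    and ext_lift_wedge: "ext_lift g (wedge us) = g us"
  using theI'[OF ext_universal[OF ext.module_axioms assms]] unfolding ext_lift_def by auto

lemma wedge_add: "wedge (us @ (u + v) # vs) = wedge (us @ u # vs) + wedge (us @ v # vs)"
  and wedge_smult: "wedge (us @ smult a u # vs) = ext_scale a (wedge (us @ u # vs))"
  and wedge_same: "wedge (us @ u # u # vs) = 0"
  using wedge_alt_multilin unfolding alt_multilin_def by blast+

lemma wedge_swap: "wedge (us @ u # v # vs) = - wedge (us @ v # u # vs)"
proof -
  have "0 = wedge (us @ (u + v) # (u + v) # vs)" by (simp add: wedge_same)
  also have "\<dots> = wedge (us @ u # v # vs) + wedge (us @ v # u # vs)"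
    using wedge_add[of "us @ [u]" u v vs] wedge_add[of "us @ [v]" u v vs]
      wedge_same[of us u vs] wedge_same[of us v vs] wedge_add[of us u v "(u + v) # vs"]
    by simp
  finally show ?thesis by (simp add: eq_neg_iff_add_eq_0)
qed

lemma alt_multilin_Cons: "alt_multilin ext_scale (\<lambda>us. wedge (f # us))"
  unfolding alt_multilin_def
  using wedge_add[of "f # _"] wedge_smult[of "f # _"] wedge_same[of "f # _"] by simp

lemma wedge_left_wedge: "wedge_left f (wedge us) = wedge (f # us)"
  and wedge_left_hom: "module_hom ext_scale ext_scale (wedge_left f)"
  unfolding wedge_left_def
  by (rule ext_lift_wedge[OF alt_multilin_Cons] ext_lift_hom[OF alt_multilin_Cons])+


lemma wedge_left_poly:
  shows wedge_left_add_poly: "wedge_left (u + v) x = wedge_left u x + wedge_left v x"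
    and wedge_left_smult_poly: "wedge_left (smult a u) x = ext_scale a (wedge_left u x)"
    and wedge_left_same: "wedge_left u (wedge_left u x) = 0"
proof -
  interpret U: module_hom ext_scale ext_scale "wedge_left u" by (rule wedge_left_hom)
  interpret V: module_hom ext_scale ext_scale "wedge_left v" by (rule wedge_left_hom)
  interpret UV: module_hom ext_scale ext_scale "wedge_left (u + v)" by (rule wedge_left_hom)
  interpret AU: module_hom ext_scale ext_scale "wedge_left (smult a u)" by (rule wedge_left_hom)
  obtain p where p: "x = (\<Sum>us\<in>Poly_Mapping.keys p. ext_scale (Poly_Mapping.lookup p us) (wedge us))"
    using ext_expand by blast
  show "wedge_left (u + v) x = wedge_left u x + wedge_left v x"
    unfolding p U.sum V.sum UV.sum U.scale V.scale UV.scale wedge_left_wedge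
    using wedge_add[of "[]" u v] by (simp add: ext.scale_right_distrib sum.distrib)
  show "wedge_left (smult a u) x = ext_scale a (wedge_left u x)"
    unfolding p U.sum AU.sum U.scale AU.scale wedge_left_wedge ext.scale_sum_right
    using wedge_smult[of "[]" a u] by (simp add: mult.commute)
  show "wedge_left u (wedge_left u x) = 0"
    unfolding p U.sum U.scale wedge_left_wedge
    using wedge_same[of "[]" u] by simp
qed

lemma wedge_left_anticomm: "wedge_left u (wedge_left v x) = - wedge_left v (wedge_left u x)"
proof -
  interpret U: module_hom ext_scale ext_scale "wedge_left u" by (rule wedge_left_hom)
  interpret V: module_hom ext_scale ext_scale "wedge_left v" by (rule wedge_left_hom)
  have "0 = wedge_left (u + v) (wedge_left (u + v) x)" by (simp only: wedge_left_same)
  also have "\<dots> = wedge_left u (wedge_left v x) + wedge_left v (wedge_left u x)"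
    by (simp add: wedge_left_add_poly U.add V.add wedge_left_same)
  finally show ?thesis by (simp add: eq_neg_iff_add_eq_0)
qed

definition contract_raw :: "('k::comm_ring_1 poly \<Rightarrow> 'k) \<Rightarrow> 'k poly list \<Rightarrow> 'k ext" where
  "contract_raw \<phi> us = (\<Sum>k<length us.
     ext_scale ((-1) ^ k * \<phi> (us ! k)) (wedge (take k us @ drop (Suc k) us)))"

lemma contract_raw_Cons:
  "contract_raw \<phi> (u # us) = ext_scale (\<phi> u) (wedge us) - wedge_left u (contract_raw \<phi> us)"
proof -
  interpret U: module_hom ext_scale ext_scale "wedge_left u" by (rule wedge_left_hom)
  show ?thesis
    unfolding contract_raw_def length_Cons sum.lessThan_Suc_shift
    by (simp add: U.sum U.scale wedge_left_wedge sum_negf)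
qed

lemma contract_alt_multilin:
  assumes add: "\<And>u v. \<phi> (u + v) = \<phi> u + \<phi> v" and smult: "\<And>a u. \<phi> (smult a u) = a * \<phi> u"
  shows "alt_multilin ext_scale (contract_raw \<phi>)"
  unfolding alt_multilin_def
proof (intro conjI allI)
  fix us vs :: "'a poly list" and u v a
  show "contract_raw \<phi> (us @ (u + v) # vs) = contract_raw \<phi> (us @ u # vs) + contract_raw \<phi> (us @ v # vs)"
  proof (induct us)
    case Nil
    then show ?case
      by (simp add: contract_raw_Cons add wedge_left_add_poly ext.scale_left_distrib)
  next
    case (Cons w us)
    interpret W: module_hom ext_scale ext_scale "wedge_left w" by (rule wedge_left_hom)
    show ?case using Cons
      by (simp add: contract_raw_Cons wedge_add W.add ext.scale_right_distrib)
  qed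
  show "contract_raw \<phi> (us @ smult a u # vs) = ext_scale a (contract_raw \<phi> (us @ u # vs))"
  proof (induct us)
    case Nil
    then show ?case
      by (simp add: contract_raw_Cons smult wedge_left_smult_poly ext.scale_right_diff_distrib)
  next
    case (Cons w us)
    interpret W: module_hom ext_scale ext_scale "wedge_left w" by (rule wedge_left_hom)
    show ?case using Cons
      by (simp add: contract_raw_Cons wedge_smult W.scale ext.scale_right_diff_distrib mult.commute)
  qed
  show "contract_raw \<phi> (us @ u # u # vs) = 0"
  proof (induct us)
    case Nil
    interpret U: module_hom ext_scale ext_scale "wedge_left u" by (rule wedge_left_hom)
    show ?case
      by (simp add: contract_raw_Cons U.diff U.scale wedge_left_same wedge_left_wedge)
  next
    case (Cons w us)
    interpret W: module_hom ext_scale ext_scale "wedge_left w" by (rule wedge_left_hom)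
    show ?case using Cons
      by (simp add: contract_raw_Cons wedge_same W.zero)
  qed
qed

lemma
  assumes "\<And>u v. \<phi> (u + v) = \<phi> u + \<phi> v" and "\<And>a u. \<phi> (smult a u) = a * \<phi> u"
  shows contract_hom: "module_hom ext_scale ext_scale (contract \<phi>)"
    and contract_wedge: "contract \<phi> (wedge us) = (\<Sum>k<length us.
      ext_scale ((-1) ^ k * \<phi> (us ! k)) (wedge (take k us @ drop (Suc k) us)))"
  using ext_lift_hom[OF contract_alt_multilin[of \<phi>]]
    ext_lift_wedge[OF contract_alt_multilin[of \<phi>], of us] assms
  unfolding contract_def contract_raw_def by auto

definition sigma_raw :: "nat \<Rightarrow> 'k::comm_ring_1 poly list \<Rightarrow> 'k ext" where
  "sigma_raw i us = (\<Sum>as | length as = length us \<and> sum_list as = i.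
     wedge (map2 (\<lambda>a u. monom 1 a * u) as us))"

lemma finite_compositions: "finite {as :: nat list. length as = n \<and> sum_list as = i}"
proof (rule finite_subset)
  show "{as. length as = n \<and> sum_list as = i} \<subseteq> {as. set as \<subseteq> {..i} \<and> length as = n}"
    by (auto dest: member_le_sum_list)
  show "finite {as. set as \<subseteq> {..i} \<and> length as = n}"
    by (rule finite_lists_length_eq) simp
qed

lemma sigma_raw_Nil: "sigma_raw i [] = (if i = 0 then wedge [] else 0)"
proof -
  have "{as :: nat list. length as = 0 \<and> sum_list as = i} = (if i = 0 then {[]} else {})"
    by auto
  then show ?thesis by (simp add: sigma_raw_def)
qed

lemma sigma_raw_Cons:
  "sigma_raw i (u # us) = (\<Sum>a\<le>i. wedge_left (monom 1 a * u) (sigma_raw (i - a) us))"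
proof -
  let ?S = "\<lambda>n i. {as :: nat list. length as = n \<and> sum_list as = i}"
  have eq: "?S (length (u # us)) i = (\<lambda>(a, as). a # as) ` (SIGMA a:{..i}. ?S (length us) (i - a))"
    by (auto simp: length_Suc_conv image_iff)
  have "sigma_raw i (u # us) =
      (\<Sum>(a, as)\<in>(SIGMA a:{..i}. ?S (length us) (i - a)).
         wedge (map2 (\<lambda>a u. monom 1 a * u) (a # as) (u # us)))"
    unfolding sigma_raw_def eq
    by (subst sum.reindex) (auto simp: inj_on_def intro!: sum.cong)
  also have "\<dots> = (\<Sum>a\<le>i. \<Sum>as\<in>?S (length us) (i - a).
         wedge (map2 (\<lambda>a u. monom 1 a * u) (a # as) (u # us)))"
    by (subst sum.Sigma) (auto simp: finite_compositions)
  also have "\<dots> = (\<Sum>a\<le>i. wedge_left (monom 1 a * u) (sigma_raw (i - a) us))"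
  proof (rule sum.cong)
    fix a
    interpret U: module_hom ext_scale ext_scale "wedge_left (monom 1 a * u)" by (rule wedge_left_hom)
    show "(\<Sum>as\<in>?S (length us) (i - a). wedge (map2 (\<lambda>a u. monom 1 a * u) (a # as) (u # us))) =
          wedge_left (monom 1 a * u) (sigma_raw (i - a) us)"
      by (simp add: sigma_raw_def U.sum wedge_left_wedge)
  qed simp
  finally show ?thesis .
qed

lemma sum_antisym:
  fixes T :: "nat \<Rightarrow> nat \<Rightarrow> 'b::ab_group_add"
  assumes "\<And>a b. T b a = - T a b" "\<And>a. T a a = 0"
  shows "(\<Sum>a\<le>i. \<Sum>b\<le>i - a. T a b) = 0"
proof -
  let ?P = "{(a, b). a + b \<le> i}"
  let ?L = "{(a, b). a + b \<le> i \<and> a < b}" and ?G = "{(a, b). a + b \<le> i \<and> b < a}"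
  let ?D = "{(a, b). a + b \<le> i \<and> a = b}"
  have fin: "finite ?P"
    by (rule finite_subset[of _ "{..i} \<times> {..i}"]) auto
  have fins: "finite ?L" "finite ?G" "finite ?D"
    by (rule finite_subset[OF _ fin], force)+
  have "(\<Sum>a\<le>i. \<Sum>b\<le>i - a. T a b) = (\<Sum>(a, b)\<in>(SIGMA a:{..i}. {..i - a}). T a b)"
    by (simp add: sum.Sigma)
  also have "(SIGMA a:{..i}. {..i - a}) = ?L \<union> (?G \<union> ?D)" by auto
  also have "(\<Sum>(a, b)\<in>?L \<union> (?G \<union> ?D). T a b) =
      (\<Sum>(a, b)\<in>?L. T a b) + ((\<Sum>(a, b)\<in>?G. T a b) + (\<Sum>(a, b)\<in>?D. T a b))"
    using fins by (subst sum.union_disjoint, auto)+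
  also have "(\<Sum>(a, b)\<in>?D. T a b) = 0"
    by (rule sum.neutral) (auto simp: assms(2))
  also have "(\<Sum>(a, b)\<in>?G. T a b) = (\<Sum>(a, b)\<in>?L. T b a)"
    by (rule sum.reindex_bij_witness[of _ prod.swap prod.swap]) auto
  also have "\<dots> = - (\<Sum>(a, b)\<in>?L. T a b)"
    unfolding sum_negf[symmetric] by (rule sum.cong) (auto intro: assms(1))
  finally show ?thesis by simp
qed

lemma sigma_alt_multilin: "alt_multilin ext_scale (sigma_raw i)"
  unfolding alt_multilin_def
proof (intro conjI allI)
  fix us vs :: "'a poly list" and u v a
  show "sigma_raw i (us @ (u + v) # vs) = sigma_raw i (us @ u # vs) + sigma_raw i (us @ v # vs)"
  proof (induct us arbitrary: i)
    case Nil
    then show ?case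
      by (simp add: sigma_raw_Cons wedge_left_add_poly distrib_left sum.distrib)
  next
    case (Cons w us)
    have "wedge_left f (x + y) = wedge_left f x + wedge_left f y" for f :: "'a poly" and x y
      using wedge_left_hom by (rule module_hom.add)
    then show ?case by (simp add: sigma_raw_Cons Cons sum.distrib)
  qed
  show "sigma_raw i (us @ smult a u # vs) = ext_scale a (sigma_raw i (us @ u # vs))"
  proof (induct us arbitrary: i)
    case Nil
    then show ?case
      by (simp add: sigma_raw_Cons wedge_left_smult_poly ext.scale_sum_right)
  next
    case (Cons w us)
    have "wedge_left f (ext_scale b x) = ext_scale b (wedge_left f x)" for f :: "'a poly" and b x
      using wedge_left_hom by (rule module_hom.scale)
    then show ?case by (simp add: sigma_raw_Cons Cons ext.scale_sum_right)
  qed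
  show "sigma_raw i (us @ u # u # vs) = 0"
  proof (induct us arbitrary: i)
    case Nil
    have eq: "wedge_left f (sum g A) = (\<Sum>x\<in>A. wedge_left f (g x))"
      for f :: "'a poly" and g :: "nat \<Rightarrow> 'a ext" and A
      using wedge_left_hom by (rule module_hom.sum)
    have "sigma_raw i (u # u # vs) = (\<Sum>a\<le>i. \<Sum>b\<le>i - a.
       wedge_left (monom 1 a * u) (wedge_left (monom 1 b * u) (sigma_raw (i - (a + b)) vs)))"
      by (simp add: sigma_raw_Cons eq)
    also have "\<dots> = 0"
    proof (rule sum_antisym)
      fix a b
      show "wedge_left (monom 1 b * u) (wedge_left (monom 1 a * u) (sigma_raw (i - (b + a)) vs)) =
          - wedge_left (monom 1 a * u) (wedge_left (monom 1 b * u) (sigma_raw (i - (a + b)) vs))"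
        unfolding add.commute[of b a] by (rule wedge_left_anticomm)
    qed (rule wedge_left_same)
    finally show ?case by simp
  next
    case (Cons w us)
    have "wedge_left f 0 = 0" for f :: "'a poly"
      using wedge_left_hom by (rule module_hom.zero)
    then show ?case by (simp add: sigma_raw_Cons Cons)
  qed
qed

lemma
  shows sigma_hom: "module_hom ext_scale ext_scale (sigma i)"
    and sigma_wedge: "sigma i (wedge us) = (\<Sum>as | length as = length us \<and> sum_list as = i.
      wedge (map2 (\<lambda>a u. monom 1 a * u) as us))"
  using ext_lift_hom[OF sigma_alt_multilin] ext_lift_wedge[OF sigma_alt_multilin, of i us]
  unfolding sigma_def sigma_raw_def by auto


lemma sigma_wedge_raw: "sigma i (wedge us) = sigma_raw i us"
  by (simp add: sigma_wedge sigma_raw_def)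

lemma module_hom_comp:
  "module_hom s1 s2 f \<Longrightarrow> module_hom s2 s3 g \<Longrightarrow> module_hom s1 s3 (\<lambda>x. g (f x))"
  using module_hom_compose[of s1 s2 f s3 g] by (simp add: comp_def)

lemma ext_sum_hom:
  "(\<And>a. a \<in> A \<Longrightarrow> module_hom ext_scale ext_scale (G a)) \<Longrightarrow>
    module_hom ext_scale ext_scale (\<lambda>x. \<Sum>a\<in>A. G a x)"
  by (rule ext_pair.module_hom_sum) (auto intro: ext.module_axioms)

lemma sigma_wedge_left:
  "sigma i (wedge_left u x) = (\<Sum>a\<le>i. wedge_left (monom 1 a * u) (sigma (i - a) x))"
proof -
  have "(\<lambda>x. sigma i (wedge_left u x)) =
      (\<lambda>x. \<Sum>a\<le>i. wedge_left (monom 1 a * u) (sigma (i - a) x))"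
  proof (rule ext_hom_eqI)
    show "module_hom ext_scale ext_scale (\<lambda>x. sigma i (wedge_left u x))"
      by (rule module_hom_comp[OF wedge_left_hom sigma_hom])
    show "module_hom ext_scale ext_scale
        (\<lambda>x. \<Sum>a\<le>i. wedge_left (monom 1 a * u) (sigma (i - a) x))"
      by (rule ext_sum_hom, rule module_hom_comp[OF sigma_hom wedge_left_hom])
  qed (simp add: wedge_left_wedge sigma_wedge_raw sigma_raw_Cons)
  then show ?thesis by (rule fun_cong)
qed

lemma sigma_wedge_left_Suc:
  "sigma (Suc i) (wedge_left u x) =
     wedge_left u (sigma (Suc i) x) + sigma i (wedge_left (monom 1 1 * u) x)"
  unfolding sigma_wedge_left sum.atMost_Suc_shift
  by (simp add: mult.assoc[symmetric] mult_monom one_poly_eq_simps)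

lemma sigma_0: "sigma 0 x = x"
proof -
  have "sigma 0 = (\<lambda>x :: 'a ext. x)"
  proof (rule ext_hom_eqI)
    show "sigma 0 (wedge us) = wedge us" for us :: "'a poly list"
    proof (induct us)
      case Nil
      then show ?case by (simp add: sigma_wedge_raw sigma_raw_Nil)
    next
      case (Cons u us)
      then show ?case
        by (simp add: wedge_left_wedge[symmetric] sigma_wedge_left one_poly_eq_simps)
    qed
  qed (auto intro: sigma_hom ext.module_hom_ident)
  then show ?thesis by (rule fun_cong)
qed

lemma sigma_commute: "sigma i (sigma j x) = sigma j (sigma i x)"
proof -
  have "(\<lambda>x. sigma i (sigma j x)) = (\<lambda>x :: 'a ext. sigma j (sigma i x))" for i j
  proof (rule ext_hom_eqI)
    show "sigma i (sigma j (wedge us)) = sigma j (sigma i (wedge us))" for us :: "'a poly list"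
    proof (induct us arbitrary: i j)
      case Nil
      have "sigma k 0 = (0 :: 'a ext)" for k
        using sigma_hom by (rule module_hom.zero)
      then show ?case by (simp add: sigma_wedge_raw sigma_raw_Nil)
    next
      case (Cons u us)
      have sum: "sigma k (sum g A) = (\<Sum>a\<in>A. sigma k (g a))" for k and g :: "nat \<Rightarrow> 'a ext" and A
        using sigma_hom by (rule module_hom.sum)
      have "sigma i (sigma j (wedge (u # us))) = (\<Sum>b\<le>j. \<Sum>a\<le>i.
          wedge_left (monom 1 a * (monom 1 b * u)) (sigma (i - a) (sigma (j - b) (wedge us))))" for i j
        by (simp add: wedge_left_wedge[symmetric] sigma_wedge_left sum)
      note eq = this
      show ?case
        unfolding eq by (subst sum.swap) (simp add: Cons[of "i - _" "j - _"] mult.left_commute)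
    qed
  qed (rule module_hom_comp[OF sigma_hom sigma_hom])+
  then show ?thesis by (rule fun_cong)
qed

text \<open>For a finite type \<open>'n\<close> with \<open>n\<close> elements, \<open>'n idx\<close> is the index set \<open>{1, \<dots>, n}\<close>, so that
  \<open>('n idx \<Rightarrow>\<^sub>0 nat) \<Rightarrow>\<^sub>0 'k\<close> is the polynomial ring over \<open>'k\<close> in exactly \<open>n\<close> indeterminates.\<close>

typedef ('n::finite) idx = "{1..CARD('n)}"
  by (rule exI[of _ 1]) (simp add: Suc_leI)

text \<open>The \<open>i\<close>-th indeterminate, with the conventions \<open>c\<^sub>0 = 1\<close> and \<open>c\<^sub>i = 0\<close> for \<open>i > n\<close>.\<close>

definition gen :: "nat \<Rightarrow> (('n::finite idx \<Rightarrow>\<^sub>0 nat) \<Rightarrow>\<^sub>0 'k::comm_ring_1)" where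
  "gen i = (if i = 0 then 1 else if i \<le> CARD('n)
     then Poly_Mapping.single (Poly_Mapping.single (Abs_idx i) 1) 1 else 0)"

text \<open>\<open>1 - c\<^sub>1z + \<dots> + (-1)\<^sup>nc\<^sub>nz\<^sup>n\<close> and its inverse series.\<close>

definition gen_series :: "(('n::finite idx \<Rightarrow>\<^sub>0 nat) \<Rightarrow>\<^sub>0 'k::comm_ring_1) fps" where
  "gen_series = Abs_fps (\<lambda>i. (-1) ^ i * gen i)"

definition gen_series_inv :: "(('n::finite idx \<Rightarrow>\<^sub>0 nat) \<Rightarrow>\<^sub>0 'k::comm_ring_1) fps" where
  "gen_series_inv = fps_right_inverse gen_series 1"

definition base :: "'k::comm_ring_1 \<Rightarrow> (('n idx \<Rightarrow>\<^sub>0 nat) \<Rightarrow>\<^sub>0 'k)" where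
  "base a = Poly_Mapping.single 0 a"

lemma gen_series_inv: "gen_series * gen_series_inv = 1"
  unfolding gen_series_inv_def by (rule fps_right_inverse) (simp add: gen_series_def gen_def)

text \<open>
  Since \<open>E\<^sub>r(z) \<Sum>h\<^sub>jz\<^sup>j = 1\<close>, that is \<open>e\<^sub>i = \<Sum>\<^bsub>1\<le>j\<le>i\<^esub> (-1)\<^sup>j\<^sup>-\<^sup>1 h\<^sub>j e\<^sub>i\<^sub>-\<^sub>j\<close>, the requirement that \<open>h\<^sub>j\<close>
  acts as \<open>\<sigma>\<^sub>j\<close> dictates how \<open>e\<^sub>i\<close> acts, hence how \<open>K[e\<^sub>1, \<dots>, e\<^sub>r]\<close> acts.  The lemma \<open>act_h\<close>
  below confirms that on \<open>\<Lambda>\<^sup>r K[X]\<close> all \<open>h\<^sub>j\<close> do act as \<open>\<sigma>\<^sub>j\<close>.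
\<close>

fun ext_e :: "nat \<Rightarrow> 'k::comm_ring_1 ext \<Rightarrow> 'k ext" where
  "ext_e 0 x = x"
| "ext_e (Suc i) x = (\<Sum>j\<le>i. ext_scale ((-1) ^ j) (sigma (Suc j) (ext_e (i - j) x)))"

definition act_monom :: "('r::finite idx \<Rightarrow>\<^sub>0 nat) \<Rightarrow> 'k::comm_ring_1 ext \<Rightarrow> 'k ext" where
  "act_monom m = foldr (\<lambda>i. ext_e i ^^ Poly_Mapping.lookup m (Abs_idx i)) [1..<Suc CARD('r)]"

definition act ::
  "(('r::finite idx \<Rightarrow>\<^sub>0 nat) \<Rightarrow>\<^sub>0 'k::comm_ring_1) \<Rightarrow> 'k ext \<Rightarrow> 'k ext" where
  "act b x = (\<Sum>m\<in>Poly_Mapping.keys b. ext_scale (Poly_Mapping.lookup b m) (act_monom m x))"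

lemma ext_e_hom: "module_hom ext_scale ext_scale (ext_e i)"
proof (induct i rule: less_induct)
  case (less i)
  show ?case
  proof (cases i)
    case 0
    have "ext_e 0 = (\<lambda>x :: 'a ext. x)" by auto
    then show ?thesis using 0 ext.module_hom_ident by metis
  next
    case (Suc k)
    have "module_hom ext_scale ext_scale
        (\<lambda>x :: 'a ext. \<Sum>j\<in>{..k}. ext_scale ((-1) ^ j) (sigma (Suc j) (ext_e (k - j) x)))"
    proof (rule ext_sum_hom)
      fix j
      have "module_hom ext_scale ext_scale (ext_e (k - j) :: 'a ext \<Rightarrow> _)" by (rule less) (simp add: Suc)
      then have "module_hom ext_scale ext_scale (\<lambda>x :: 'a ext. sigma (Suc j) (ext_e (k - j) x))"
        by (rule module_hom_comp[OF _ sigma_hom])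
      then show "module_hom ext_scale ext_scale (\<lambda>x :: 'a ext. ext_scale ((-1) ^ j) (sigma (Suc j) (ext_e (k - j) x)))"
        by (rule ext_pair.module_hom_scale)
    qed
    then show ?thesis unfolding Suc ext_e.simps(2)[abs_def] by simp
  qed
qed

lemma sigma_ext_e_commute: "sigma k (ext_e i x) = ext_e i (sigma k x)"
proof (induct i arbitrary: x rule: less_induct)
  case (less i)
  interpret S: module_hom ext_scale ext_scale "sigma k" by (rule sigma_hom)
  show ?case
  proof (cases i)
    case (Suc n)
    show ?thesis unfolding Suc ext_e.simps S.sum S.scale
    proof (rule sum.cong)
      fix j assume "j \<in> {..n}"
      then show "ext_scale ((-1) ^ j) (sigma k (sigma (Suc j) (ext_e (n - j) x))) =
          ext_scale ((-1) ^ j) (sigma (Suc j) (ext_e (n - j) (sigma k x)))"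
        using less[of "n - j" x] by (simp add: Suc sigma_commute[of k "Suc j"])
    qed simp
  qed simp
qed

lemma ext_e_commute: "ext_e k (ext_e i x) = ext_e i (ext_e k x)"
proof (induct i arbitrary: x rule: less_induct)
  case (less i)
  interpret S: module_hom ext_scale ext_scale "ext_e k" by (rule ext_e_hom)
  show ?case
  proof (cases i)
    case (Suc n)
    show ?thesis unfolding Suc ext_e.simps S.sum S.scale
    proof (rule sum.cong)
      fix j assume "j \<in> {..n}"
      then show "ext_scale ((-1) ^ j) (ext_e k (sigma (Suc j) (ext_e (n - j) x))) =
          ext_scale ((-1) ^ j) (sigma (Suc j) (ext_e (n - j) (ext_e k x)))"
        using less[of "n - j" x] by (simp add: Suc sigma_ext_e_commute[symmetric])
    qed simp
  qed simp
qed

lemma ext_e_rec: "(\<Sum>j\<le>Suc i. ext_scale ((-1) ^ j) (sigma j (ext_e (Suc i - j) x))) = 0"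
proof -
  have "(\<Sum>j\<le>i. ext_scale ((-1) ^ Suc j) (sigma (Suc j) (ext_e (i - j) x))) = - ext_e (Suc i) x"
    by (simp add: sum_negf)
  then show ?thesis unfolding sum.atMost_Suc_shift by (simp add: sigma_0 del: ext_e.simps(2))
qed

lemma ext_e_wedge_left:
  "ext_e (Suc i) (wedge_left u x) = wedge_left u (ext_e (Suc i) x) + wedge_left (monom 1 1 * u) (ext_e i x)"
proof (induct i arbitrary: x rule: less_induct)
  case (less i)
  let ?X = "monom 1 1 * u"
  have ua: "wedge_left f (y + z) = wedge_left f y + wedge_left f z" for f :: "'a poly" and y z
    using wedge_left_hom by (rule module_hom.add)
  have us: "wedge_left f (ext_scale b y) = ext_scale b (wedge_left f y)" for f :: "'a poly" and b y
    using wedge_left_hom by (rule module_hom.scale)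
  have usum: "wedge_left f (sum g A) = (\<Sum>a\<in>A. wedge_left f (g a))"
    for f :: "'a poly" and g :: "nat \<Rightarrow> 'a ext" and A
    using wedge_left_hom by (rule module_hom.sum)
  have sadd: "sigma k (y + z) = sigma k y + sigma k z" for k and y z :: "'a ext"
    using sigma_hom by (rule module_hom.add)
  define P where "P j = ext_scale ((-1) ^ j) (wedge_left u (sigma (Suc j) (ext_e (i - j) x)))" for j
  define Q where "Q j = ext_scale ((-1) ^ j) (sigma j (wedge_left ?X (ext_e (i - j) x)))" for j
  have step: "ext_scale ((-1) ^ j) (sigma (Suc j) (ext_e (i - j) (wedge_left u x))) =
      P j + Q j - (if j < i then Q (Suc j) else 0)" if "j \<le> i" for j
  proof (cases "j = i")
    case True
    then show ?thesis
      by (simp add: sigma_wedge_left_Suc P_def Q_def ext.scale_right_distrib)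
  next
    case False
    then have "j < i" using that by simp
    then have e: "i - j = Suc (i - Suc j)" by simp
    have "ext_e (i - j) (wedge_left u x) = wedge_left u (ext_e (i - j) x) + wedge_left ?X (ext_e (i - Suc j) x)"
      unfolding e by (rule less) (use \<open>j < i\<close> in simp)
    then show ?thesis using \<open>j < i\<close>
      by (simp add: sadd sigma_wedge_left_Suc P_def Q_def ext.scale_right_distrib)
  qed
  have "ext_e (Suc i) (wedge_left u x) = (\<Sum>j\<le>i. P j + Q j - (if j < i then Q (Suc j) else 0))"
    unfolding ext_e.simps by (rule sum.cong) (simp_all add: step)
  also have "\<dots> = (\<Sum>j\<le>i. P j) + ((\<Sum>j\<le>i. Q j) - (\<Sum>j\<le>i. if j < i then Q (Suc j) else 0))"
    by (simp add: sum.distrib sum_subtractf)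
  also have "(\<Sum>j\<le>i. if j < i then Q (Suc j) else 0) = (\<Sum>j<i. Q (Suc j))"
    by (rule sum.mono_neutral_cong_right) auto
  also have "(\<Sum>j\<le>i. Q j) = Q 0 + (\<Sum>j<i. Q (Suc j))"
    by (rule sum.atMost_shift)
  also have "(\<Sum>j\<le>i. P j) = wedge_left u (ext_e (Suc i) x)"
    by (simp add: P_def usum us)
  finally show ?case by (simp add: Q_def sigma_0)
qed

lemma ext_e_eq_0: "length us < i \<Longrightarrow> ext_e i (wedge us) = 0"
proof (induct us arbitrary: i)
  case Nil
  then obtain k where i: "i = Suc k" by (cases i) auto
  have "ext_e (Suc k) (wedge []) = (0 :: 'a ext)" for k
  proof -
    have "sigma (Suc j) (ext_e m (wedge [])) = (0 :: 'a ext)" for j m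
    proof -
      interpret E: module_hom ext_scale ext_scale "ext_e m :: 'a ext \<Rightarrow> _" by (rule ext_e_hom)
      show ?thesis
        by (simp add: sigma_ext_e_commute sigma_wedge_raw sigma_raw_Nil)
    qed
    then show ?thesis by simp
  qed
  then show ?case using i by blast
next
  case (Cons u us)
  then obtain k where i: "i = Suc k" by (cases i) auto
  have "wedge_left f 0 = 0" for f :: "'a poly"
    using wedge_left_hom by (rule module_hom.zero)
  then show ?case using Cons
    by (simp add: i wedge_left_wedge[symmetric] ext_e_wedge_left del: ext_e.simps)
qed

lemma funpow_commute:
  assumes "\<And>x. f (g x) = g (f x)"
  shows "(f ^^ n) (g x) = g ((f ^^ n) x)"
  by (induct n) (simp_all add: assms)

lemma foldr_funpow_add:
  assumes c: "\<And>i j x. f i (f j x) = f j (f i x)"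
  shows "foldr (\<lambda>i. f i ^^ (a i + b i)) xs x =
         foldr (\<lambda>i. f i ^^ a i) xs (foldr (\<lambda>i. f i ^^ b i) xs x)"
proof (induct xs)
  case (Cons k xs)
  have c1: "(f i ^^ n) ((f j ^^ l) x) = (f j ^^ l) ((f i ^^ n) x)" for i j n l x
    by (rule funpow_commute, rule funpow_commute[symmetric], rule c)
  have "(f k ^^ n) (foldr (\<lambda>i. f i ^^ a i) ys y) = foldr (\<lambda>i. f i ^^ a i) ys ((f k ^^ n) y)" for n ys y
    by (induct ys) (simp_all add: c1[where i=k])
  then show ?case by (simp add: Cons funpow_add[of "a k" "b k"])
qed simp

lemma act_monom_add: "act_monom (m + m') x = act_monom m (act_monom m' x)"
  unfolding act_monom_def lookup_add by (rule foldr_funpow_add) (rule ext_e_commute)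

lemma act_monom_0: "act_monom 0 x = x"
proof -
  have "foldr (\<lambda>i. ext_e i ^^ 0) xs x = x" for xs
    by (induct xs) auto
  then show ?thesis by (simp add: act_monom_def)
qed

lemma act_monom_single:
  assumes "1 \<le> i" "i \<le> CARD('r::finite)"
  shows "act_monom (Poly_Mapping.single (Abs_idx i :: 'r idx) 1) x = ext_e i x"
proof -
  have eq: "(Abs_idx i :: 'r idx) = Abs_idx j \<longleftrightarrow> i = j" if "1 \<le> j" "j \<le> CARD('r)" for j
    using that assms by (simp add: Abs_idx_inject)
  have "foldr (\<lambda>j. ext_e j ^^ Poly_Mapping.lookup (Poly_Mapping.single (Abs_idx i :: 'r idx) 1) (Abs_idx j)) xs x =
      (if i \<in> set xs then ext_e i x else x)"
    if "set xs \<subseteq> {1..CARD('r)}" "distinct xs" for xs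
    using that by (induct xs) (auto simp: lookup_single eq when_def)
  from this[of "[1..<Suc CARD('r)]"] show ?thesis
    unfolding act_monom_def using assms by (simp add: atLeastLessThanSuc_atLeastAtMost del: upt_Suc)
qed

lemma funpow_hom:
  "module_hom ext_scale ext_scale F \<Longrightarrow> module_hom ext_scale ext_scale (\<lambda>x. (F ^^ n) x)"
proof (induct n)
  case (Suc n)
  then show ?case by (simp, intro module_hom_comp[of _ _ "F ^^ n" _ F]) auto
qed (simp add: ext.module_hom_ident id_def)

lemma act_monom_hom: "module_hom ext_scale ext_scale (act_monom m)"
proof -
  have "module_hom ext_scale ext_scale (\<lambda>x. foldr (\<lambda>i. ext_e i ^^ a i) xs x)" for a xs
  proof (induct xs)
    case (Cons k xs)
    from module_hom_comp[OF this funpow_hom[OF ext_e_hom]] show ?case by simp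
  qed (simp add: ext.module_hom_ident)
  then show ?thesis unfolding act_monom_def by simp
qed

lemma act_superset:
  "finite A \<Longrightarrow> Poly_Mapping.keys b \<subseteq> A \<Longrightarrow>
     act b x = (\<Sum>m\<in>A. ext_scale (Poly_Mapping.lookup b m) (act_monom m x))"
  unfolding act_def by (rule sum.mono_neutral_left) (auto simp: in_keys_iff)

lemma act_add_left: "act (p + q) x = act p x + act q x"
proof -
  let ?A = "Poly_Mapping.keys p \<union> Poly_Mapping.keys q"
  show ?thesis
    by (subst (1 2 3) act_superset[of ?A])
      (simp_all add: Poly_Mapping.keys_add lookup_add ext.scale_left_distrib sum.distrib)
qed

lemma act_0_left: "act 0 x = 0"
  by (simp add: act_def)

lemma act_sum_left: "act (sum f A) x = (\<Sum>a\<in>A. act (f a) x)"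
  by (induct A rule: infinite_finite_induct) (simp_all add: act_add_left act_0_left)

lemma act_single: "act (Poly_Mapping.single m a) x = ext_scale a (act_monom m x)"
  by (subst act_superset[of "{m}"]) (auto simp: lookup_single)

lemma act_base: "act (base a) x = ext_scale a x"
  by (simp add: base_def act_single act_monom_0)

lemma act_hom: "module_hom ext_scale ext_scale (act b)"
  unfolding act_def
  by (intro ext_sum_hom ext_pair.module_hom_scale act_monom_hom)

lemma act_mult: "act (p * q) x = act p (act q x)"
proof -
  have expand: "r = (\<Sum>m\<in>Poly_Mapping.keys r. Poly_Mapping.single m (Poly_Mapping.lookup r m))"
    for r :: "('b idx \<Rightarrow>\<^sub>0 nat) \<Rightarrow>\<^sub>0 'a"
  proof -
    have "fscale a (Poly_Mapping.single m 1) = Poly_Mapping.single m a"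
      for a :: 'a and m :: "'b idx \<Rightarrow>\<^sub>0 nat"
      by (rule poly_mapping_eqI) (simp add: lookup_single when_def)
    then show ?thesis using poly_mapping_expand[of r] by simp
  qed
  have mono: "act (Poly_Mapping.single m a * q) x = act (Poly_Mapping.single m a) (act q x)" for m a
  proof -
    interpret M: module_hom ext_scale ext_scale "act_monom m :: 'a ext \<Rightarrow> _" by (rule act_monom_hom)
    have "act (Poly_Mapping.single m a * q) x =
        act (Poly_Mapping.single m a * (\<Sum>m'\<in>Poly_Mapping.keys q. Poly_Mapping.single m' (Poly_Mapping.lookup q m'))) x"
      by (simp only: expand[of q, symmetric])
    also have "\<dots> = (\<Sum>m'\<in>Poly_Mapping.keys q.
        ext_scale (a * Poly_Mapping.lookup q m') (act_monom m (act_monom m' x)))"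
      by (simp add: sum_distrib_left act_sum_left mult_single act_single act_monom_add)
    also have "\<dots> = act (Poly_Mapping.single m a) (act q x)"
      by (simp add: act_single act_def[of q] M.sum M.scale ext.scale_sum_right)
    finally show ?thesis .
  qed
  have "act (p * q) x = act ((\<Sum>m\<in>Poly_Mapping.keys p. Poly_Mapping.single m (Poly_Mapping.lookup p m)) * q) x"
    by (simp only: expand[of p, symmetric])
  also have "\<dots> = (\<Sum>m\<in>Poly_Mapping.keys p. act (Poly_Mapping.single m (Poly_Mapping.lookup p m)) (act q x))"
    by (simp add: sum_distrib_right act_sum_left mono)
  also have "\<dots> = act p (act q x)"
    by (simp only: act_sum_left[symmetric] expand[of p, symmetric])
  finally show ?thesis .
qed

lemma act_gen:
  assumes "length us = CARD('r::finite)"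
  shows "act (gen i :: ('r idx \<Rightarrow>\<^sub>0 nat) \<Rightarrow>\<^sub>0 'k::comm_ring_1) (sigma k (wedge us)) =
    sigma k (ext_e i (wedge us))"
proof -
  interpret S: module_hom ext_scale ext_scale "sigma k :: 'k ext \<Rightarrow> _" by (rule sigma_hom)
  consider "i = 0" | "1 \<le> i" "i \<le> CARD('r)" | "CARD('r) < i" by linarith
  then show ?thesis
  proof cases
    case 1
    then show ?thesis using act_base[of 1] by (simp add: gen_def base_def)
  next
    case 2
    then show ?thesis
      by (simp add: gen_def act_single act_monom_single[simplified] sigma_ext_e_commute)
  next
    case 3
    then show ?thesis using ext_e_eq_0[of us i] assms by (simp add: gen_def act_0_left)
  qed
qed

theorem act_h:
  assumes us: "length us = CARD('r::finite)"
  shows "act (fps_nth gen_series_inv i :: ('r idx \<Rightarrow>\<^sub>0 nat) \<Rightarrow>\<^sub>0 'k::comm_ring_1) (wedge us) =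
    sigma i (wedge us)"
proof (induct i rule: less_induct)
  case (less i)
  let ?h = "fps_nth (gen_series_inv :: (('r idx \<Rightarrow>\<^sub>0 nat) \<Rightarrow>\<^sub>0 'k) fps)"
  let ?e = "gen :: nat \<Rightarrow> ('r idx \<Rightarrow>\<^sub>0 nat) \<Rightarrow>\<^sub>0 'k"
  let ?W = "wedge us :: 'k ext"
  have act1: "act 1 x = x" for x :: "'k ext"
    using act_base[of 1] by (simp add: base_def)
  have neg: "act ((-1) ^ j * p) x = ext_scale ((-1) ^ j) (act p x)"
    for j and p :: "('r idx \<Rightarrow>\<^sub>0 nat) \<Rightarrow>\<^sub>0 'k" and x
  proof -
    have "(-1) ^ j = (base ((-1) ^ j) :: ('r idx \<Rightarrow>\<^sub>0 nat) \<Rightarrow>\<^sub>0 'k)"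
      by (induct j) (simp_all add: base_def single_uminus)
    then show ?thesis by (simp add: act_mult act_base)
  qed
  show ?case
  proof (cases i)
    case 0
    have "?h 0 = 1" by (simp add: gen_series_inv_def)
    then show ?thesis by (simp add: 0 act1 sigma_0)
  next
    case (Suc n)
    have "(\<Sum>j\<le>Suc n. (-1) ^ j * ?e j * ?h (Suc n - j)) = 0"
      using arg_cong[OF gen_series_inv, of "\<lambda>f. fps_nth f (Suc n)"]
      by (simp add: fps_mult_nth gen_series_def atLeast0AtMost del: sum.atMost_Suc)
    then have "0 = (\<Sum>j\<le>Suc n. act ((-1) ^ j * (?e j * ?h (Suc n - j))) ?W)"
      by (simp only: act_sum_left[symmetric] act_0_left mult.assoc)
    also have "\<dots> = (\<Sum>j\<le>Suc n. ext_scale ((-1) ^ j) (act (?e j) (act (?h (Suc n - j)) ?W)))"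
      unfolding neg by (simp only: act_mult)
    also have "\<dots> = act (?h (Suc n)) ?W +
        (\<Sum>j\<le>n. ext_scale ((-1) ^ Suc j) (act (?e (Suc j)) (act (?h (n - j)) ?W)))"
      unfolding sum.atMost_Suc_shift by (simp add: gen_def act1)
    also have "(\<Sum>j\<le>n. ext_scale ((-1) ^ Suc j) (act (?e (Suc j)) (act (?h (n - j)) ?W))) =
        (\<Sum>j\<le>n. ext_scale ((-1) ^ Suc j) (sigma (n - j) (ext_e (Suc j) ?W)))"
      by (rule sum.cong) (simp_all add: less Suc act_gen[OF us] del: ext_e.simps)
    also have "\<dots> = - sigma (Suc n) ?W"
    proof -
      have "(\<Sum>j\<le>Suc n. ext_scale ((-1) ^ (Suc n - j)) (sigma (Suc n - j) (ext_e j ?W))) =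
          (\<Sum>j\<le>Suc n. ext_scale ((-1) ^ j) (sigma j (ext_e (Suc n - j) ?W)))"
        by (rule sum.reindex_bij_witness[of _ "\<lambda>j. Suc n - j" "\<lambda>j. Suc n - j"])
          (auto simp del: ext_e.simps)
      then have "0 = ext_scale ((-1) ^ Suc n) (\<Sum>j\<le>Suc n. ext_scale ((-1) ^ (Suc n - j)) (sigma (Suc n - j) (ext_e j ?W)))"
        by (simp only: ext_e_rec ext.scale_zero_right)
      also have "\<dots> = (\<Sum>j\<le>Suc n. ext_scale ((-1) ^ j) (sigma (Suc n - j) (ext_e j ?W)))"
        unfolding ext.scale_sum_right
      proof (rule sum.cong)
        fix j assume "j \<in> {..Suc n}"
        then have "(-1 :: 'k) ^ Suc n * (-1) ^ (Suc n - j) = (-1) ^ j"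
          by (metis atMost_iff le_add_diff_inverse left_minus_one_mult_self mult.commute power_add)
        then show "ext_scale ((-1) ^ Suc n) (ext_scale ((-1) ^ (Suc n - j)) (sigma (Suc n - j) (ext_e j ?W))) =
            ext_scale ((-1) ^ j) (sigma (Suc n - j) (ext_e j ?W))"
          by (simp only: ext.scale_scale)
      qed simp
      also have "\<dots> = sigma (Suc n) ?W +
          (\<Sum>j\<le>n. ext_scale ((-1) ^ Suc j) (sigma (n - j) (ext_e (Suc j) ?W)))"
        unfolding sum.atMost_Suc_shift by (simp del: ext_e.simps(2))
      finally show ?thesis by (simp add: eq_neg_iff_add_eq_0 add.commute)
    qed
    finally show ?thesis by (simp add: Suc)
  qed
qed

type_synonym 'n B0 = "('n idx \<Rightarrow>\<^sub>0 nat) \<Rightarrow>\<^sub>0 rat"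
type_synonym ('n, 'r) Br = "('r idx \<Rightarrow>\<^sub>0 nat) \<Rightarrow>\<^sub>0 'n B0"

definition Xc :: "nat \<Rightarrow> 'n::finite B0 poly" where
  "Xc j = (\<Sum>i\<le>j. monom ((-1) ^ i * gen i) (j - i))"

text \<open>
  \<open>\<partial>\<^sup>j(s)\<close> is the coefficient of \<open>w\<^sup>-\<^sup>j\<close> in the Laurent series \<open>\<s>(w) \<partial>(w\<^sup>-\<^sup>1)\<close>.  This product also
  contains positive powers of \<open>w\<close>, so \<open>j\<close> ranges over all integers; the forms with \<open>j \<ge> 0\<close> are
  the basis dual to \<open>(X\<^sup>i(c))\<close>.
\<close>

definition partial_s :: "int \<Rightarrow> 'n::finite B0 poly \<Rightarrow> 'n B0" where
  "partial_s j p = fls_nth (fps_to_fls gen_series_inv *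
     (\<Sum>i\<le>degree p. fls_const (coeff p i) * fls_X_inv ^ i)) (- j)"

definition is_partition :: "nat \<Rightarrow> nat list \<Rightarrow> bool" where
  "is_partition r lam \<longleftrightarrow> length lam = r \<and> sorted_wrt (\<ge>) lam"

definition X_wedge :: "nat list \<Rightarrow> 'n::finite B0 ext" where
  "X_wedge lam = wedge (map (\<lambda>j. Xc (length lam - 1 - j + lam ! j)) [0..<length lam])"

definition c_series :: "('n::finite, 'r::finite) Br fps" where
  "c_series = Abs_fps (\<lambda>i. base (fps_nth gen_series i))"

definition s_series :: "('n::finite, 'r::finite) Br fps" where
  "s_series = Abs_fps (\<lambda>i. base (fps_nth gen_series_inv i))"

definition h_c :: "int \<Rightarrow> ('n::finite, 'r::finite) Br" where
  "h_c j = (if j < 0 then 0 else fps_nth (c_series * gen_series_inv) (nat j))"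

text \<open>Rows and columns are numbered from \<open>0\<close>; \<open>\<lambda>\<^sub>j - j + k\<close> is unaffected by this shift.\<close>

definition Delta :: "nat list \<Rightarrow> ('n::finite, 'r::finite) Br" where
  "Delta lam = det (mat CARD('r) CARD('r) (\<lambda>(k, j). h_c (int (lam ! j) - int j + int k)))"

definition star ::
  "'n::finite B0 poly \<Rightarrow> ('n B0 poly \<Rightarrow> 'n B0) \<Rightarrow> ('n, 'r::finite) Br \<Rightarrow> ('n, 'r) Br" where
  "star f \<phi> p = (THE b. \<exists>lam. is_partition CARD('r) lam \<and> p = Delta lam \<and>
     act b (X_wedge (replicate CARD('r) 0)) = wedge_left f (contract \<phi> (X_wedge lam)))"

text \<open>
  The \<open>\<star>\<close>-product of a generating function \<open>\<Sum> X\<^sup>i(c) z\<^sup>i \<otimes> \<partial>\<^sup>j(s) w\<^sup>-\<^sup>j\<close> with \<open>\<Delta>\<^sub>\<lambda>\<close> is formed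
  coefficientwise: its coefficient at \<open>z\<^sup>i w\<^sup>-\<^sup>j\<close> is \<open>star (Xc i) (partial_s j) (Delta \<lambda>)\<close>.
\<close>

text \<open>Series in \<open>z\<close> and \<open>w\<close> live in \<open>B\<^sub>r(c)((w))((z))\<close>: the outer variable is \<open>z\<close>, the inner one \<open>w\<close>.\<close>

definition in_z :: "'a::comm_ring_1 fps \<Rightarrow> 'a fls fls" where
  "in_z f = fps_to_fls (Abs_fps (\<lambda>i. fls_const (fps_nth f i)))"

definition in_w :: "'a::comm_ring_1 fps \<Rightarrow> 'a fls fls" where
  "in_w f = fls_const (fps_to_fls f)"

definition zvar :: "'a::comm_ring_1 fls fls" where "zvar = fls_X"
definition zvar_inv :: "'a::comm_ring_1 fls fls" where "zvar_inv = fls_X_inv"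
definition wvar :: "'a::comm_ring_1 fls fls" where "wvar = fls_const fls_X"
definition wvar_inv :: "'a::comm_ring_1 fls fls" where "wvar_inv = fls_const fls_X_inv"

definition scalar :: "'a::comm_ring_1 \<Rightarrow> 'a fls fls" where
  "scalar a = fls_const (fls_const a)"

definition w_inv_c :: "nat \<Rightarrow> ('n::finite, 'r::finite) Br fls fls" where
  "w_inv_c m = poly (map_poly (\<lambda>a. scalar (base a)) (Xc m)) wvar_inv"

definition sigma_bar_h :: "int \<Rightarrow> ('n::finite, 'r::finite) Br fls fls" where
  "sigma_bar_h j = scalar (h_c j) - scalar (h_c (j - 1)) * zvar_inv"

definition Delta_wz :: "nat list \<Rightarrow> ('n::finite, 'r::finite) Br fls fls" where
  "Delta_wz lam = wvar ^ (CARD('r) - 1) * det (mat CARD('r) CARD('r) (\<lambda>(k, j).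
     if k = 0 then w_inv_c (CARD('r) - 1 - j + lam ! j)
     else sigma_bar_h (int (lam ! j) - int j + int k)))"

lemma partial_s_eq:
  assumes "degree p \<le> N"
  shows "partial_s j p =
    (\<Sum>i\<le>N. coeff p i * (if j \<le> int i then fps_nth gen_series_inv (nat (int i - j)) else 0))"
proof -
  have "partial_s j p = (\<Sum>i\<le>degree p. coeff p i *
      (if j \<le> int i then fps_nth gen_series_inv (nat (int i - j)) else 0))"
    unfolding partial_s_def sum_distrib_left fls_nth_sum
  proof (rule sum.cong)
    fix i
    have "fps_to_fls gen_series_inv * (fls_const (coeff p i) * fls_X_inv ^ i) =
        fls_const (coeff p i) * fls_shift (int i) (fps_to_fls gen_series_inv)"
      by (simp only: mult.left_commute[of "fps_to_fls gen_series_inv" "fls_const (coeff p i)"]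
          fls_X_inv_power_times_conv_shift(2)[of "fps_to_fls gen_series_inv"])
    then show "fls_nth (fps_to_fls gen_series_inv * (fls_const (coeff p i) * fls_X_inv ^ i)) (- j) =
        coeff p i * (if j \<le> int i then fps_nth gen_series_inv (nat (int i - j)) else 0)"
      by simp
  qed simp
  also have "\<dots> = (\<Sum>i\<le>N. coeff p i *
      (if j \<le> int i then fps_nth gen_series_inv (nat (int i - j)) else 0))"
    by (rule sum.mono_neutral_left) (use assms in \<open>auto simp: coeff_eq_0\<close>)
  finally show ?thesis .
qed

lemma partial_s_linear:
  "partial_s j (p + q) = partial_s j p + partial_s j q"
  "partial_s j (smult a p) = a * partial_s j p"
proof -
  show "partial_s j (p + q) = partial_s j p + partial_s j q"
    using degree_add_le_max[of p q]
    by (simp add: partial_s_eq[of _ "max (degree p) (degree q)"] distrib_right sum.distrib)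
  show "partial_s j (smult a p) = a * partial_s j p"
    using degree_smult_le[of a p]
    by (simp add: partial_s_eq[of _ "degree p"] sum_distrib_left mult.assoc)
qed

lemma coeff_Xc: "coeff (Xc m) i = (if i \<le> m then (-1) ^ (m - i) * gen (m - i) else 0)"
proof -
  have "coeff (Xc m) i = (\<Sum>k\<le>m. if k = m - i \<and> i \<le> m then (-1) ^ k * gen k else 0)"
    unfolding Xc_def coeff_sum by (rule sum.cong) auto
  then show ?thesis by (cases "i \<le> m") (simp_all add: sum.delta)
qed

lemma partial_s_dual: "partial_s (int j) (Xc i :: 'n::finite B0 poly) = (if i = j then 1 else 0)"
proof -
  let ?s = "fps_nth (gen_series_inv :: 'n B0 fps)" and ?c = "fps_nth (gen_series :: 'n B0 fps)"
  have deg: "degree (Xc i :: 'n B0 poly) \<le> i"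
    by (rule degree_le) (simp add: coeff_Xc)
  have "partial_s (int j) (Xc i :: 'n B0 poly) =
      (\<Sum>k\<le>i. ?c (i - k) * (if j \<le> k then ?s (k - j) else 0))"
    unfolding partial_s_eq[OF deg]
    by (intro sum.cong) (auto simp: coeff_Xc gen_series_def nat_diff_distrib')
  also have "\<dots> = (\<Sum>k\<in>{j..i}. ?c (i - k) * ?s (k - j))"
    by (rule sum.mono_neutral_cong_right) auto
  also have "\<dots> = (if i = j then 1 else 0)"
  proof (cases "j \<le> i")
    case True
    have "(\<Sum>k\<in>{j..i}. ?c (i - k) * ?s (k - j)) = (\<Sum>k\<le>i - j. ?c k * ?s (i - j - k))"
      by (rule sum.reindex_bij_witness[of _ "\<lambda>k. i - k" "\<lambda>k. i - k"]) (use True in auto)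
    also have "\<dots> = fps_nth (gen_series * gen_series_inv :: 'n B0 fps) (i - j)"
      by (simp add: fps_mult_nth atLeast0AtMost)
    finally show ?thesis using True by (simp add: gen_series_inv)
  qed auto
  finally show ?thesis .
qed

end

theory Submission
  imports Defs
begin

text \<open>
  Put \<open>m\<^sub>q = r - 1 - q + \<lambda>\<^sub>q\<close> for \<open>0 \<le> q < r\<close>, so that \<open>[X(c)]\<^sub>\<lambda>\<close> is the wedge of the \<open>X\<^bsup>m\<^sub>q\<^esup>(c)\<close>.
  The series \<open>\<Sum> \<partial>\<^sup>j(s) w\<^sup>-\<^sup>j\<close> takes the value \<open>\<s>(w) w\<^sup>-\<^sup>m(c)\<close> at \<open>X\<^sup>m(c)\<close>.  Contracting
  \<open>[X(c)]\<^sub>\<lambda>\<close> with it therefore produces \<open>\<Sum>\<^sub>q (-1)\<^sup>q \<s>(w) w\<^bsup>-m\<^sub>q\<^esup>(c)\<close> times the wedge without its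
  \<open>q\<close>-th factor.  This is the expansion of the determinant on the right hand side along its first
  row, and what remains is to identify, for every \<open>q\<close>, the wedge of \<open>\<Sum> X\<^sup>i(c) z\<^sup>i\<close> with the remaining
  factors as the multiple of \<open>[X(c)]\<^sub>0\<close> by \<open>z\<^sup>r\<^sup>-\<^sup>1 \<c>(z)/E\<^sub>r(z)\<close> and the corresponding minor.

  By the determinantal formula, a wedge of \<open>r\<close> elements \<open>X\<^bsup>n\<^sub>j\<^esup>(c)\<close> is \<open>det(h\<^bsub>n\<^sub>j - (r-1) + k\<^esub>(c)) [X(c)]\<^sub>0\<close>
  for arbitrary exponents.  With the generating function in the first place, the first
  column of this determinant is \<open>z\<^bsup>r-1-k\<^esup> \<c>(z)/E\<^sub>r(z)\<close>, for \<open>k = 0, \<dots>, r-1\<close>.  Subtracting from each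
  row \<open>z\<^sup>-\<^sup>1\<close> times the row above clears that column below its top entry and turns every other \<open>h\<^sub>j(c)\<close> into
  \<open>h\<^sub>j(c) - h\<^sub>j\<^sub>-\<^sub>1(c) z\<^sup>-\<^sup>1\<close>, which is exactly the minor wanted (\<open>det_sigma_bar_h\<close>).

  The determinantal formula, and the fact that \<open>\<star>\<close> is well defined, both come from the freeness of
  \<open>\<Lambda>\<^sup>r V\<close> over \<open>K[e\<^sub>1, \<dots>, e\<^sub>r]\<close> on \<open>X\<^sup>r\<^sup>-\<^sup>1 \<and> \<dots> \<and> 1\<close> (\<open>ext_deg_free\<close>), which has two halves.  Generation
  (\<open>stair_generated\<close>): the operators \<open>\<sigma>\<^sub>i\<close> allow any factor \<open>X\<^sup>a\<close> to be traded for a \<open>1\<close>, and behind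
  a \<open>1\<close> every \<open>e\<^sub>j\<close> pushes the sequence \<open>1, X, \<dots>, X\<^sup>k\<^sup>-\<^sup>1\<close> up to \<open>X, \<dots>, X\<^sup>k\<close>, so that the staircase grows.
  Independence: the form \<open>coord\<close> sending \<open>X\<^bsup>n\<^sub>1\<^esup> \<and> \<dots> \<and> X\<^bsup>n\<^sub>r\<^esup>\<close> to \<open>det(h\<^bsub>n\<^sub>j - (r-1) + k\<^esub>)\<close> takes the value \<open>1\<close>
  on the generator and is linear over \<open>K[e\<^sub>1, \<dots>, e\<^sub>r]\<close> (\<open>coord_act\<close>), because the recurrence
  \<open>E\<^sub>r(t) \<Sum> h\<^sub>j t\<^sup>j = 1\<close> makes \<open>\<Sum> \<sigma>\<^sub>i t\<^sup>i\<close> multiply such determinants by \<open>1/E\<^sub>r(t)\<close>.  Hence \<open>coord\<close> reads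
  off the coordinate of every element, and the determinantal formula is the computation of
  this coordinate.
\<close>

section \<open>Homogeneous parts of the exterior algebra\<close>

lemma ext_hom_rules:
  "wedge_left f (x + y) = wedge_left f x + wedge_left f y"
  "wedge_left f (ext_scale a x) = ext_scale a (wedge_left f x)"
  "wedge_left f (- x) = - wedge_left f x"
  "wedge_left f 0 = 0"
  "wedge_left f (sum g A) = (\<Sum>b\<in>A. wedge_left f (g b))"
  "sigma i (x + y) = sigma i x + sigma i y"
  "sigma i (ext_scale a x) = ext_scale a (sigma i x)"
  "sigma i 0 = 0"
  "sigma i (sum g A) = (\<Sum>b\<in>A. sigma i (g b))"
  "ext_e i (x + y) = ext_e i x + ext_e i y"
  "ext_e i (ext_scale a x) = ext_scale a (ext_e i x)"
  "ext_e i 0 = 0"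
  by (rule module_hom.add[OF wedge_left_hom] module_hom.scale[OF wedge_left_hom]
      module_hom.neg[OF wedge_left_hom] module_hom.zero[OF wedge_left_hom] module_hom.sum[OF wedge_left_hom]
      module_hom.add[OF sigma_hom] module_hom.scale[OF sigma_hom]
      module_hom.zero[OF sigma_hom] module_hom.sum[OF sigma_hom]
      module_hom.add[OF ext_e_hom] module_hom.scale[OF ext_e_hom] module_hom.zero[OF ext_e_hom])+

lemma act_hom_rules:
  "act b (x + y) = act b x + act b y"
  "act b (ext_scale a x) = ext_scale a (act b x)"
  "act b 0 = 0"
  "act b (sum g A) = (\<Sum>c\<in>A. act b (g c))"
  by (rule module_hom.add[OF act_hom] module_hom.scale[OF act_hom]
      module_hom.zero[OF act_hom] module_hom.sum[OF act_hom])+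

definition ext_deg :: "nat \<Rightarrow> 'k::comm_ring_1 ext set" where
  "ext_deg m = ext.span {wedge us | us. length us = m}"

lemma ext_deg_wedge: "length us = m \<Longrightarrow> wedge us \<in> ext_deg m"
  unfolding ext_deg_def by (rule ext.span_base) blast

lemma ext_deg_closed:
  "0 \<in> ext_deg m"
  "x \<in> ext_deg m \<Longrightarrow> y \<in> ext_deg m \<Longrightarrow> x + y \<in> ext_deg m"
  "x \<in> ext_deg m \<Longrightarrow> ext_scale a x \<in> ext_deg m"
  "(\<And>b. b \<in> A \<Longrightarrow> g b \<in> ext_deg m) \<Longrightarrow> sum g A \<in> ext_deg m"
  unfolding ext_deg_def
  by (auto intro: ext.span_zero ext.span_add ext.span_scale ext.span_sum)

lemma ext_deg_induct [consumes 1, case_names zero add scale wedge]: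
  assumes "x \<in> ext_deg m"
    and "P 0" and "\<And>x y. P x \<Longrightarrow> P y \<Longrightarrow> P (x + y)" and "\<And>a x. P x \<Longrightarrow> P (ext_scale a x)"
    and "\<And>us. length us = m \<Longrightarrow> P (wedge us)"
  shows "P x"
  using assms(1) unfolding ext_deg_def
proof (induct rule: ext.span_induct_alt)
  case (step c x y)
  then show ?case using assms(3,4,5) by blast
qed (rule assms(2))

lemma wedge_left_ext_deg: "x \<in> ext_deg m \<Longrightarrow> wedge_left f x \<in> ext_deg (Suc m)"
  by (induct rule: ext_deg_induct)
    (auto simp: ext_hom_rules wedge_left_wedge intro: ext_deg_closed ext_deg_wedge)

lemma sigma_ext_deg: "x \<in> ext_deg m \<Longrightarrow> sigma i x \<in> ext_deg m"
proof (induct rule: ext_deg_induct)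
  case (wedge us)
  then show ?case by (auto simp: sigma_wedge intro!: ext_deg_closed(4) ext_deg_wedge)
qed (auto simp: ext_hom_rules intro: ext_deg_closed)

lemma ext_e_ext_deg: "x \<in> ext_deg m \<Longrightarrow> ext_e i x \<in> ext_deg m"
proof (induct i arbitrary: x rule: less_induct)
  case (less i)
  show ?case
  proof (cases i)
    case 0
    then show ?thesis using less by simp
  next
    case (Suc k)
    then show ?thesis using less
      by (auto intro!: ext_deg_closed sigma_ext_deg)
  qed
qed

section \<open>Generation of the top exterior power by one element\<close>

text \<open>
  The element \<open>X\<^sup>k\<^sup>-\<^sup>1 \<and> \<dots> \<and> X \<and> 1 \<and> x\<close>: the intermediate stages in the reduction of an arbitrary wedge to
  multiples of \<open>X\<^sup>r\<^sup>-\<^sup>1 \<and> \<dots> \<and> 1\<close>.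
\<close>

primrec stair :: "nat \<Rightarrow> 'k::comm_ring_1 ext \<Rightarrow> 'k ext" where
  "stair 0 x = x"
| "stair (Suc k) x = wedge_left (monom 1 k) (stair k x)"

lemma stair_hom_rules:
  "stair k (x + y) = stair k x + stair k y"
  "stair k (ext_scale a x) = ext_scale a (stair k x)"
  "stair k 0 = 0"
  by (induct k) (simp_all add: ext_hom_rules)

lemma stair_wedge: "stair k (wedge us) = wedge (map (monom 1) (rev [0..<k]) @ us)"
  by (induct k) (simp_all add: wedge_left_wedge)

lemma stair_wedge_left: "stair k (wedge_left u x) = ext_scale ((-1) ^ k) (wedge_left u (stair k x))"
proof (induct k)
  case (Suc k)
  show ?case
    by (simp only: stair.simps Suc ext_hom_rules wedge_left_anticomm[of "monom 1 k" u])
      (simp flip: ext.scale_minus_left)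
qed simp

text \<open>
  On a wedge, \<open>e\<^sub>j\<close> is the sum over all ways to multiply \<open>j\<close> of the factors by \<open>X\<close>.  After wedging with
  \<open>1\<close>, the factor \<open>1\<close> of the staircase has to be raised to \<open>X\<close>, which then collides with the old
  \<open>X\<close> unless that one is raised too, and so on.  So only the terms raising all \<open>k\<close> steps survive,
  and \<open>j - k\<close> raises are left for \<open>x\<close>.
\<close>

lemma wedge_left_1_ext_e_stair:
  "wedge_left 1 (ext_e j (stair k x)) =
     (if k \<le> j then ext_scale ((-1) ^ k) (stair (Suc k) (ext_e (j - k) x)) else 0)"
proof (induct k arbitrary: j)
  case 0
  show ?case by (simp add: one_poly_eq_simps)
next
  case (Suc k)
  let ?W = "\<lambda>k. wedge_left (monom 1 k :: 'a poly)"
  show ?case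
  proof (cases j)
    case 0
    have "wedge_left 1 (?W k (stair k x)) = - ?W k (wedge_left 1 (ext_e 0 (stair k x)))"
      by (simp add: wedge_left_anticomm[of 1])
    also have "\<dots> = 0"
      unfolding Suc by (auto simp: ext_hom_rules wedge_left_same)
    finally show ?thesis using 0 by simp
  next
    case j: (Suc i)
    have "wedge_left 1 (ext_e j (stair (Suc k) x)) =
        - ?W k (wedge_left 1 (ext_e j (stair k x))) - ?W (Suc k) (wedge_left 1 (ext_e i (stair k x)))"
      unfolding j stair.simps ext_e_wedge_left ext_hom_rules
      by (simp add: wedge_left_anticomm[of 1] mult_monom del: ext_e.simps)
    also have "?W k (wedge_left 1 (ext_e j (stair k x))) = 0"
      unfolding Suc by (auto simp: ext_hom_rules wedge_left_same)
    finally show ?thesis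
      unfolding Suc j by (auto simp: ext_hom_rules)
  qed
qed

text \<open>
  The recurrence \<open>ext_e_rec\<close> with the two factors exchanged: \<open>\<Sum> \<sigma>\<^sub>i t\<^sup>i\<close> and \<open>\<Sum> (-1)\<^sup>j e\<^sub>j t\<^sup>j\<close> are inverse to
  each other.
\<close>

lemma sigma_ext_e_sum:
  "(\<Sum>j\<le>n. ext_scale ((-1) ^ j) (sigma (n - j) (ext_e j x))) = (if n = 0 then x else 0)"
proof (cases n)
  case 0
  then show ?thesis by (simp add: sigma_0)
next
  case (Suc i)
  have "(\<Sum>j\<le>n. ext_scale ((-1) ^ j) (sigma (n - j) (ext_e j x))) =
      (\<Sum>j\<le>n. ext_scale ((-1) ^ (n - j)) (sigma j (ext_e (n - j) x)))"
    by (rule sum.reindex_bij_witness[of _ "\<lambda>j. n - j" "\<lambda>j. n - j"]) (auto simp del: ext_e.simps)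
  also have "\<dots> = ext_scale ((-1) ^ n) (\<Sum>j\<le>n. ext_scale ((-1) ^ j) (sigma j (ext_e (n - j) x)))"
    unfolding ext.scale_sum_right
  proof (rule sum.cong)
    fix j assume "j \<in> {..n}"
    then have "(-1 :: 'a) ^ (n - j) = (-1) ^ n * (-1) ^ j"
      by (metis atMost_iff le_add_diff_inverse left_minus_one_mult_self mult.commute power_add)
    then show "ext_scale ((-1) ^ (n - j)) (sigma j (ext_e (n - j) x)) =
        ext_scale ((-1) ^ n) (ext_scale ((-1) ^ j) (sigma j (ext_e (n - j) x)))"
      by (simp only: ext.scale_scale)
  qed simp
  also have "\<dots> = 0"
    unfolding Suc ext_e_rec by simp
  finally show ?thesis using Suc by simp
qed

lemma sum_triangle_swap:
  fixes f :: "nat \<Rightarrow> nat \<Rightarrow> 'b::comm_monoid_add"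
  shows "(\<Sum>j\<le>a. \<Sum>b\<le>a - j. f j b) = (\<Sum>b\<le>a. \<Sum>j\<le>a - b. f j b)"
  unfolding sum.Sigma[OF finite_atMost ballI[OF finite_atMost]]
  by (rule sum.reindex_bij_witness[of _ prod.swap prod.swap]) auto

text \<open>
  The series \<open>\<sigma>(t) = \<Sum> \<sigma>\<^sub>i t\<^sup>i\<close> is multiplicative for the wedge and sends \<open>1\<close> to \<open>\<Sum> X\<^sup>a t\<^sup>a\<close>.  With its inverse
  \<open>\<epsilon>(t) = \<Sum> (-1)\<^sup>j e\<^sub>j t\<^sup>j\<close>, this gives \<open>\<sigma>(t)(1 \<and> \<epsilon>(t) x) = \<sigma>(t) 1 \<and> x\<close>, whose coefficient at \<open>t\<^sup>a\<close> is the claim.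
  It trades a factor \<open>X\<^sup>a\<close> for a factor \<open>1\<close>.
\<close>

lemma wedge_left_monom_expand:
  "wedge_left (monom 1 a) x =
     (\<Sum>j\<le>a. ext_scale ((-1) ^ j) (sigma (a - j) (wedge_left 1 (ext_e j x))))"
proof -
  have "(\<Sum>j\<le>a. ext_scale ((-1) ^ j) (sigma (a - j) (wedge_left 1 (ext_e j x)))) =
      (\<Sum>j\<le>a. \<Sum>b\<le>a - j. wedge_left (monom 1 b)
         (ext_scale ((-1) ^ j) (sigma (a - b - j) (ext_e j x))))"
    by (simp only: sigma_wedge_left ext.scale_sum_right ext_hom_rules mult_1_right diff_commute[of a])
  also have "\<dots> = (\<Sum>b\<le>a. wedge_left (monom 1 b)
      (\<Sum>j\<le>a - b. ext_scale ((-1) ^ j) (sigma (a - b - j) (ext_e j x))))"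
    by (subst sum_triangle_swap) (simp only: ext_hom_rules)
  also have "\<dots> = (\<Sum>b\<le>a. if b = a then wedge_left (monom 1 b) x else 0)"
    unfolding sigma_ext_e_sum by (intro sum.cong) (auto simp: ext_hom_rules)
  finally show ?thesis by simp
qed

lemma idx_cases:
  obtains i where "1 \<le> i" "i \<le> CARD('r::finite)" "(k :: 'r idx) = Abs_idx i"
  by (cases k) auto

text \<open>
  Statements about the action of all of \<open>K[e\<^sub>1, \<dots>, e\<^sub>r]\<close> follow from those about constants and the
  \<open>e\<^sub>i\<close>.
\<close>

lemma mpoly_induct [case_names base gen add mult]:
  fixes b :: "('r::finite idx \<Rightarrow>\<^sub>0 nat) \<Rightarrow>\<^sub>0 'k::comm_ring_1"
  assumes base: "\<And>a. P (base a)"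
    and gen: "\<And>i. 1 \<le> i \<Longrightarrow> i \<le> CARD('r) \<Longrightarrow> P (gen i)"
    and add: "\<And>p q. P p \<Longrightarrow> P q \<Longrightarrow> P (p + q)"
    and mult: "\<And>p q. P p \<Longrightarrow> P q \<Longrightarrow> P (p * q)"
  shows "P b"
proof -
  have zero: "P 0" and one: "P 1"
    using base[of 0] base[of 1] by (simp_all add: base_def)
  have mono: "P (Poly_Mapping.single m 1)" for m :: "'r idx \<Rightarrow>\<^sub>0 nat"
  proof (induct m rule: update_induct)
    case const
    show ?case using one by simp
  next
    case (update m k n)
    have upd: "Poly_Mapping.update k n m = m + Poly_Mapping.single k n"
      using update(1) by (intro poly_mapping_eqI)
        (auto simp: lookup_update lookup_add lookup_single when_def in_keys_iff)
    have "P (Poly_Mapping.single (Poly_Mapping.single k n) 1)" for n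
    proof (induct n)
      case 0
      show ?case using one by simp
    next
      case (Suc n)
      obtain i where i: "1 \<le> i" "i \<le> CARD('r)" "k = Abs_idx i" by (rule idx_cases)
      have "Poly_Mapping.single (Poly_Mapping.single k (Suc n)) 1 =
          gen i * Poly_Mapping.single (Poly_Mapping.single k n) (1 :: 'k)"
        using i by (simp add: gen_def mult_single flip: single_add)
      then show ?case using mult[OF gen[OF i(1,2)] Suc] by simp
    qed
    from mult[OF update(3) this[of n]] show ?case
      unfolding upd by (simp only: mult_single mult_1_left)
  qed
  have single: "P (Poly_Mapping.single m a)" for m and a :: 'k
    using mult[OF base[of a] mono[of m]] by (simp add: base_def mult_single)
  show ?thesis
  proof (induct b rule: update_induct)
    case (update b m a)
    have "Poly_Mapping.update m a b = b + Poly_Mapping.single m a"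
      using update(1) by (intro poly_mapping_eqI)
        (auto simp: lookup_update lookup_add lookup_single when_def in_keys_iff)
    then show ?case using add[OF update(3) single] by simp
  qed (simp add: zero)
qed

lemma act_gen_eq:
  assumes "1 \<le> i" "i \<le> CARD('r::finite)"
  shows "act (gen i :: ('r idx \<Rightarrow>\<^sub>0 nat) \<Rightarrow>\<^sub>0 'k::comm_ring_1) x = ext_e i x"
  using assms act_monom_single[of i, where 'r='r] by (simp add: gen_def act_single)

lemma act_1: "act 1 x = x"
  using act_base[of 1] by (simp add: base_def)

lemma act_ext_deg: "x \<in> ext_deg m \<Longrightarrow> act b x \<in> ext_deg m"
  by (induct b arbitrary: x rule: mpoly_induct)
    (simp_all add: act_base act_gen_eq act_add_left act_mult ext_deg_closed ext_e_ext_deg)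

lemma sigma_act: "sigma i (act b x) = act b (sigma i x)"
  by (induct b arbitrary: x rule: mpoly_induct)
    (simp_all add: act_base act_gen_eq act_add_left act_mult ext_hom_rules sigma_ext_e_commute)

lemma act_h_ext_deg:
  assumes "x \<in> ext_deg CARD('r::finite)"
  shows "act (fps_nth gen_series_inv i :: ('r idx \<Rightarrow>\<^sub>0 nat) \<Rightarrow>\<^sub>0 'k::comm_ring_1) x = sigma i x"
  using assms
  by (induct rule: ext_deg_induct) (simp_all add: act_hom_rules ext_hom_rules act_h)

definition delta_wedge :: "nat \<Rightarrow> 'k::comm_ring_1 ext" where
  "delta_wedge r = wedge (map (monom 1) (rev [0..<r]))"

lemma delta_wedge_ext_deg: "delta_wedge r \<in> ext_deg r"
  unfolding delta_wedge_def by (rule ext_deg_wedge) simp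

text \<open>
  Induction on the number \<open>m\<close> of factors outside the staircase.  Such a factor can be taken to be
  \<open>X\<^sup>a\<close> and moved to the front; \<open>wedge_left_monom_expand\<close> replaces it by \<open>1\<close> at the price of
  operators \<open>\<sigma>\<^sub>i\<close>, which act as the elements \<open>h\<^sub>i\<close>, and of operators \<open>e\<^sub>j\<close> behind the \<open>1\<close>, which
  lengthen the staircase by one step.
\<close>

lemma stair_generated:
  fixes x :: "'k::comm_ring_1 ext"
  assumes "x \<in> ext_deg m" "k + m = CARD('r::finite)"
  shows "\<exists>b :: ('r idx \<Rightarrow>\<^sub>0 nat) \<Rightarrow>\<^sub>0 'k. stair k x = act b (delta_wedge CARD('r))"
  using assms
proof (induct m arbitrary: k x)
  let ?N = "range (\<lambda>b :: ('r idx \<Rightarrow>\<^sub>0 nat) \<Rightarrow>\<^sub>0 'k. act b (delta_wedge CARD('r)))"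
  have N0: "0 \<in> ?N"
    by (rule range_eqI[of _ _ 0]) (simp add: act_0_left)
  have Nadd: "y + z \<in> ?N" if "y \<in> ?N" "z \<in> ?N" for y z
    using that by (auto simp: act_add_left[symmetric])
  have Nscale: "ext_scale a y \<in> ?N" if "y \<in> ?N" for a y
    using that by (auto simp: act_base[symmetric, where 'b='r] act_mult[symmetric])
  have Nsum: "sum f A \<in> ?N" if "\<And>b. b \<in> A \<Longrightarrow> f b \<in> ?N" for f :: "nat \<Rightarrow> _" and A
    using that
  proof (induct A rule: infinite_finite_induct)
    case (insert b A)
    have "f b + sum f A \<in> ?N" by (rule Nadd) (use insert in blast)+
    then show ?case unfolding sum.insert[OF insert(1,2)] .
  qed (simp_all only: sum.infinite sum.empty N0 not_False_eq_True)
  have Nsigma: "sigma i y \<in> ?N" if "y \<in> ?N" for i y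
  proof -
    obtain b :: "('r idx \<Rightarrow>\<^sub>0 nat) \<Rightarrow>\<^sub>0 'k" where "y = act b (delta_wedge CARD('r))"
      using \<open>y \<in> ?N\<close> by blast
    then have "sigma i y = act (b * fps_nth gen_series_inv i) (delta_wedge CARD('r))"
      by (simp add: sigma_act act_mult act_h_ext_deg[OF delta_wedge_ext_deg])
    then show ?thesis by blast
  qed
  {
    case 0
    from 0(1) have "stair k x \<in> ?N"
    proof (induct rule: ext_deg_induct)
      case (wedge us)
      then have "stair k (wedge us) = act 1 (delta_wedge CARD('r))"
        using 0 by (simp add: stair_wedge delta_wedge_def act_1)
      then show ?case by blast
    qed (auto simp only: stair_hom_rules intro: N0 Nadd Nscale)
    then show ?case by blast
  next
    case (Suc m)
    have monom: "stair k (wedge_left (monom 1 a) y) \<in> ?N" if y: "y \<in> ext_deg m" for a y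
    proof -
      have "wedge_left (monom 1 a) (stair k y) \<in> ?N"
        unfolding wedge_left_monom_expand[of a] wedge_left_1_ext_e_stair
      proof (intro Nsum Nscale Nsigma)
        fix j
        have "stair (Suc k) (ext_e (j - k) y) \<in> ?N"
          using Suc(1)[OF ext_e_ext_deg[OF y], of "Suc k" "j - k"] Suc(3)
          by (auto simp del: stair.simps)
        then show "(if k \<le> j then ext_scale ((-1) ^ k) (stair (Suc k) (ext_e (j - k) y)) else 0) \<in> ?N"
          using N0 Nscale by simp
      qed
      then show ?thesis unfolding stair_wedge_left by (rule Nscale)
    qed
    have poly: "stair k (wedge_left u y) \<in> ?N" if y: "y \<in> ext_deg m" for u y
    proof -
      have "wedge_left (sum g A) y = (\<Sum>i\<in>A. wedge_left (g i) y)" for g :: "nat \<Rightarrow> 'k poly" and A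
        using wedge_left_smult_poly[of 0 0 y]
        by (induct A rule: infinite_finite_induct) (simp_all add: wedge_left_add_poly)
      note sum = this
      have "u = (\<Sum>i\<le>degree u. smult (coeff u i) (monom 1 i))"
        by (simp add: smult_monom poly_as_sum_of_monoms)
      then have "wedge_left u y = (\<Sum>i\<le>degree u. ext_scale (coeff u i) (wedge_left (monom 1 i) y))"
        by (metis (no_types, lifting) sum sum.cong wedge_left_smult_poly)
      moreover have "stair k (sum g A) = (\<Sum>i\<in>A. stair k (g i))" for g :: "nat \<Rightarrow> 'k ext" and A
        by (induct A rule: infinite_finite_induct) (simp_all add: stair_hom_rules)
      ultimately show ?thesis
        by (simp only: stair_hom_rules) (intro Nsum Nscale monom y)
    qed
    from Suc(2) have "stair k x \<in> ?N"
    proof (induct rule: ext_deg_induct)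
      case (wedge us)
      then obtain u vs where us: "us = u # vs" "length vs = m"
        by (cases us) auto
      then show ?case
        using poly[OF ext_deg_wedge[OF us(2)], of u] by (simp only: wedge_left_wedge)
    qed (auto simp only: stair_hom_rules intro: N0 Nadd Nscale)
    then show ?case by blast
  }
qed

corollary ext_deg_generated:
  assumes "x \<in> ext_deg CARD('r::finite)"
  shows "\<exists>b :: ('r idx \<Rightarrow>\<^sub>0 nat) \<Rightarrow>\<^sub>0 'k::comm_ring_1. x = act b (delta_wedge CARD('r))"
  using stair_generated[of x "CARD('r)" 0, where 'r='r] assms by simp

section \<open>The coordinate form given by Jacobi-Trudi determinants\<close>

lemma base_simps:
  "base 0 = 0" "base 1 = 1"
  "base (a + b) = base a + base b" "base (a * b) = base a * base b" "base (- a) = - base a"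
  by (simp_all add: base_def single_add mult_single single_uminus)

lemma base_sum: "base (sum f A) = (\<Sum>a\<in>A. base (f a))"
  by (induct A rule: infinite_finite_induct) (simp_all add: base_simps)

text \<open>
  The coefficients \<open>h\<^sub>z\<close> of \<open>1/E\<^sub>r(t)\<close>, extended by \<open>0\<close> to negative indices so that recurrences need no boundary cases.
\<close>

definition h_int :: "int \<Rightarrow> ('r::finite idx \<Rightarrow>\<^sub>0 nat) \<Rightarrow>\<^sub>0 'k::comm_ring_1" where
  "h_int z = (if z < 0 then 0 else fps_nth gen_series_inv (nat z))"

text \<open>
  The coefficient of \<open>E\<^sub>r(t) \<Sum> h\<^sub>j t\<^sup>j = 1\<close> at \<open>t\<^sup>z\<close>.  A bound \<open>N \<ge> r\<close> reaches all nonzero \<open>e\<^sub>i\<close>, so the sum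
  does not depend on it.
\<close>

lemma h_int_recurrence:
  assumes "CARD('r) \<le> N"
  shows "(\<Sum>i\<le>N. (-1) ^ i * gen i * h_int (z - int i)) =
    (if z = 0 then 1 else 0 :: ('r::finite idx \<Rightarrow>\<^sub>0 nat) \<Rightarrow>\<^sub>0 'k::comm_ring_1)"
proof (cases "z < 0")
  case True
  then show ?thesis by (simp add: h_int_def)
next
  case False
  let ?f = "\<lambda>i. (-1) ^ i * gen i * (h_int (z - int i) :: ('r idx \<Rightarrow>\<^sub>0 nat) \<Rightarrow>\<^sub>0 'k)"
  have "sum ?f {..N} = sum ?f {..max N (nat z)}"
    by (rule sum.mono_neutral_left) (use assms in \<open>auto simp: gen_def\<close>)
  also have "\<dots> = sum ?f {..nat z}"
    by (rule sum.mono_neutral_right) (use False in \<open>auto simp: h_int_def\<close>)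
  also have "\<dots> = fps_nth (gen_series * gen_series_inv) (nat z)"
    unfolding fps_mult_nth atLeast0AtMost
    by (rule sum.cong) (use False in \<open>auto simp: h_int_def gen_series_def nat_diff_distrib'\<close>)
  also have "\<dots> = (if z = 0 then 1 else 0)"
    using False by (simp add: gen_series_inv)
  finally show ?thesis .
qed

text \<open>
  The linear form sending \<open>X\<^sup>n\<close> to \<open>h\<^bsub>n - (r-1) + k\<^esub>\<close>.  Row \<open>k\<close> of a Jacobi-Trudi determinant consists of its
  values, and \<open>h_form_monom_mult\<close> is the reason for allowing every \<open>k\<close>: multiplication by \<open>X\<close>
  shifts the row index.
\<close>

definition h_form :: "nat \<Rightarrow> 'k::comm_ring_1 poly \<Rightarrow> ('r::finite idx \<Rightarrow>\<^sub>0 nat) \<Rightarrow>\<^sub>0 'k" where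
  "h_form k u = (\<Sum>n\<le>degree u. base (coeff u n) * h_int (int n + int k + 1 - int CARD('r)))"

lemma h_form_eq:
  assumes "degree u \<le> N"
  shows "(h_form k u :: ('r::finite idx \<Rightarrow>\<^sub>0 nat) \<Rightarrow>\<^sub>0 'k::comm_ring_1) =
    (\<Sum>n\<le>N. base (coeff u n) * h_int (int n + int k + 1 - int CARD('r)))"
  unfolding h_form_def
  by (rule sum.mono_neutral_left) (use assms in \<open>auto simp: coeff_eq_0 base_simps\<close>)

lemma h_form_add: "h_form k (u + v) = h_form k u + h_form k v"
  using degree_add_le_max[of u v]
  by (simp add: h_form_eq[of _ "max (degree u) (degree v)"] base_simps distrib_right sum.distrib)

lemma h_form_smult: "h_form k (smult a u) = base a * h_form k u"
  using degree_smult_le[of a u]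
  by (simp add: h_form_eq[of _ "degree u"] base_simps sum_distrib_left mult.assoc)

lemma h_form_monom: "h_form k (monom 1 n) = (h_int (int n + int k + 1 - int CARD('r)) ::
    ('r::finite idx \<Rightarrow>\<^sub>0 nat) \<Rightarrow>\<^sub>0 'k::comm_ring_1)"
proof -
  have "base (coeff (monom 1 n) i) * h_int (int i + int k + 1 - int CARD('r)) =
      (if i = n then h_int (int i + int k + 1 - int CARD('r)) else 0 :: ('r idx \<Rightarrow>\<^sub>0 nat) \<Rightarrow>\<^sub>0 'k)" for i
    by (simp add: base_simps)
  then show ?thesis by (simp add: h_form_eq[OF degree_monom_le])
qed

lemma h_form_monom_mult: "h_form k (monom 1 a * u) =
    (h_form (k + a) u :: ('r::finite idx \<Rightarrow>\<^sub>0 nat) \<Rightarrow>\<^sub>0 'k::comm_ring_1)"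
proof (induct a arbitrary: k)
  case 0
  then show ?case by (simp add: one_poly_eq_simps)
next
  case (Suc a)
  have "h_form k (pCons 0 v) = (h_form (Suc k) v :: ('r idx \<Rightarrow>\<^sub>0 nat) \<Rightarrow>\<^sub>0 'k)" for v
  proof -
    have "degree (pCons 0 v) \<le> Suc (degree v)" by (rule degree_pCons_le)
    from h_form_eq[OF this, of k] show ?thesis
      unfolding sum.atMost_Suc_shift
      by (simp add: base_simps h_form_def algebra_simps del: degree_pCons_eq_if)
  qed
  then show ?case using Suc by (simp add: monom_Suc)
qed

text \<open>
  Beyond row \<open>r - 1\<close>, each row is a combination of the preceding \<open>r\<close> ones, with the coefficients of
  \<open>E\<^sub>r\<close>.
\<close>

lemma h_form_recurrence:
  assumes "0 < a"
  shows "(\<Sum>i\<le>CARD('r) - 1 + a. (-1) ^ i * gen i * h_form (CARD('r) - 1 + a - i) u) =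
    (0 :: ('r::finite idx \<Rightarrow>\<^sub>0 nat) \<Rightarrow>\<^sub>0 'k::comm_ring_1)"
proof -
  let ?N = "CARD('r) - 1 + a"
  have r: "0 < CARD('r)" by simp
  have "(\<Sum>i\<le>?N. (-1) ^ i * gen i * h_form (?N - i) u) =
      (\<Sum>n\<le>degree u. base (coeff u n) *
        (\<Sum>i\<le>?N. (-1) ^ i * gen i * (h_int (int n + int a - int i) :: ('r idx \<Rightarrow>\<^sub>0 nat) \<Rightarrow>\<^sub>0 'k)))"
    unfolding h_form_def sum_distrib_left
  proof (subst sum.swap, intro sum.cong refl)
    fix n i assume "i \<in> {..?N}"
    then have "int n + int (?N - i) + 1 - int CARD('r) = int n + int a - int i"
      using r by (cases "CARD('r)") (auto simp: of_nat_diff)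
    then show "(-1) ^ i * gen i * (base (coeff u n) * h_int (int n + int (?N - i) + 1 - int CARD('r))) =
        base (coeff u n) * ((-1) ^ i * gen i * (h_int (int n + int a - int i) :: ('r idx \<Rightarrow>\<^sub>0 nat) \<Rightarrow>\<^sub>0 'k))"
      by (simp only: mult.left_commute)
  qed
  also have "\<dots> = 0"
  proof -
    have "CARD('r) \<le> ?N" using assms r by linarith
    then show ?thesis using assms by (simp only: h_int_recurrence) simp
  qed
  finally show ?thesis .
qed

text \<open>
  Laplace expansion in the column belonging to the list entry \<open>u\<close>.  The cofactors involve only the other
  entries, which yields linearity of the determinant in \<open>u\<close>.
\<close>

lemma det_expand_along_entry:
  fixes G :: "nat \<Rightarrow> 'p \<Rightarrow> 'b::comm_ring_1"
  assumes "length (us @ u # vs) = n"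
  shows "det (mat n n (\<lambda>(k, j). G k ((us @ u # vs) ! j))) =
    (\<Sum>k<n. G k u * ((-1) ^ (k + length us) *
      det (mat (n - 1) (n - 1) (\<lambda>(k', j). G (if k' < k then k' else Suc k') ((us @ vs) ! j)))))"
proof -
  let ?A = "mat n n (\<lambda>(k, j). G k ((us @ u # vs) ! j))"
  have l: "length us < n" using assms by simp
  have "det ?A = (\<Sum>k<n. ?A $$ (k, length us) * cofactor ?A k (length us))"
    by (rule laplace_expansion_column[OF _ l]) simp
  also have "\<dots> = (\<Sum>k<n. G k u * ((-1) ^ (k + length us) *
      det (mat (n - 1) (n - 1) (\<lambda>(k', j). G (if k' < k then k' else Suc k') ((us @ vs) ! j)))))"
  proof (rule sum.cong)
    fix k assume "k \<in> {..<n}"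
    then have "mat_delete ?A k (length us) =
        mat (n - 1) (n - 1) (\<lambda>(k', j). G (if k' < k then k' else Suc k') ((us @ vs) ! j))"
      using l by (intro eq_matI) (auto simp: mat_delete_def nth_append Suc_diff_le)
    then show "?A $$ (k, length us) * cofactor ?A k (length us) = G k u * ((-1) ^ (k + length us) *
      det (mat (n - 1) (n - 1) (\<lambda>(k', j). G (if k' < k then k' else Suc k') ((us @ vs) ! j))))"
      using l \<open>k \<in> {..<n}\<close> by (simp add: cofactor_def)
  qed simp
  finally show ?thesis .
qed

definition h_form_det :: "'k::comm_ring_1 poly list \<Rightarrow> ('r::finite idx \<Rightarrow>\<^sub>0 nat) \<Rightarrow>\<^sub>0 'k" where
  "h_form_det us = (if length us = CARD('r)
     then det (mat CARD('r) CARD('r) (\<lambda>(k, j). h_form k (us ! j))) else 0)"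

lemma base_module: "Modules.module (\<lambda>a b. base a * b)"
  by standard (simp_all add: base_simps algebra_simps)

lemma h_form_det_alt_multilin:
  "alt_multilin (\<lambda>a b. base a * b)
     (h_form_det :: 'k::comm_ring_1 poly list \<Rightarrow> ('r::finite idx \<Rightarrow>\<^sub>0 nat) \<Rightarrow>\<^sub>0 'k)"
  unfolding alt_multilin_def
proof (intro conjI allI)
  fix us vs :: "'k poly list" and u v a
  show "h_form_det (us @ (u + v) # vs) =
      (h_form_det (us @ u # vs) + h_form_det (us @ v # vs) :: ('r idx \<Rightarrow>\<^sub>0 nat) \<Rightarrow>\<^sub>0 'k)"
    by (cases "length (us @ u # vs) = CARD('r)")
      (simp_all add: h_form_det_def det_expand_along_entry h_form_add distrib_right sum.distrib)
  show "h_form_det (us @ smult a u # vs) =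
      (base a * h_form_det (us @ u # vs) :: ('r idx \<Rightarrow>\<^sub>0 nat) \<Rightarrow>\<^sub>0 'k)"
    by (cases "length (us @ u # vs) = CARD('r)")
      (simp_all add: h_form_det_def det_expand_along_entry h_form_smult mult.assoc sum_distrib_left)
  show "h_form_det (us @ u # u # vs) = (0 :: ('r idx \<Rightarrow>\<^sub>0 nat) \<Rightarrow>\<^sub>0 'k)"
    unfolding h_form_det_def
    by (auto intro!: det_identical_columns[of _ _ "length us" "Suc (length us)"]
        intro!: eq_vecI simp: nth_append)
qed

text \<open>
  By \<open>ext_deg_free\<close> below, this is the coordinate of an element of \<open>\<Lambda>\<^sup>r K[X]\<close> with respect to the
  generator \<open>X\<^sup>r\<^sup>-\<^sup>1 \<and> \<dots> \<and> 1\<close>.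
\<close>

definition coord :: "'k::comm_ring_1 ext \<Rightarrow> ('r::finite idx \<Rightarrow>\<^sub>0 nat) \<Rightarrow>\<^sub>0 'k" where
  "coord = (THE F. module_hom ext_scale (\<lambda>a b. base a * b) F \<and> (\<forall>us. F (wedge us) = h_form_det us))"

lemma
  shows coord_hom: "module_hom ext_scale (\<lambda>a b. base a * b) coord"
    and coord_wedge: "coord (wedge us) = h_form_det us"
  using theI'[OF ext_universal[OF base_module h_form_det_alt_multilin]] unfolding coord_def by auto

lemma coord_hom_rules:
  "coord (x + y) = coord x + coord y"
  "coord (ext_scale a x) = base a * coord x"
  "coord 0 = 0"
  "coord (sum g A) = (\<Sum>c\<in>A. coord (g c))"
  by (rule module_hom.add[OF coord_hom] module_hom.scale[OF coord_hom]
      module_hom.zero[OF coord_hom] module_hom.sum[OF coord_hom])+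

section \<open>Freeness of rank one\<close>

text \<open>
  Column \<open>j\<close> contains the values of the forms on \<open>u\<^sub>j/(1 - tX) = \<Sum> t\<^sup>a X\<^sup>a u\<^sub>j\<close>.  Since \<open>\<Sum> \<sigma>\<^sub>i t\<^sup>i\<close> applies
  \<open>1/(1 - tX)\<close> to every factor of a wedge, the determinant is the generating series of the
  coordinates of \<open>\<sigma>\<^sub>i(u\<^sub>1 \<and> \<dots> \<and> u\<^sub>r)\<close>.
\<close>

definition h_form_series_mat ::
  "'k::comm_ring_1 poly list \<Rightarrow> (('r::finite idx \<Rightarrow>\<^sub>0 nat) \<Rightarrow>\<^sub>0 'k) fps mat" where
  "h_form_series_mat us = mat CARD('r) CARD('r) (\<lambda>(k, j). Abs_fps (\<lambda>a. h_form (k + a) (us ! j)))"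

lemma fps_nth_signof_mult:
  "fps_nth (signof p * f) n = signof p * fps_nth f n" for f :: "'b::comm_ring_1 fps"
  by (cases "sign p = 1") (auto simp: sign_def)

lemma det_h_form_series_mat_nth:
  assumes us: "length us = CARD('r::finite)"
  shows "fps_nth (det (h_form_series_mat us)) i =
    (coord (sigma i (wedge us)) :: ('r idx \<Rightarrow>\<^sub>0 nat) \<Rightarrow>\<^sub>0 'k::comm_ring_1)"
proof -
  let ?r = "CARD('r)"
  let ?P = "{p. p permutes {0..<?r}}"
  obtain l where l: "?r = Suc l" using not0_implies_Suc[of ?r] by auto
  have lt: "{..<?r} = {0..l}" unfolding l by auto
  have perm: "p j < ?r" if "p \<in> ?P" "j < ?r" for p j
    using that permutes_in_image[of p "{0..<?r}" j] by simp
  have "fps_nth (det (h_form_series_mat us :: (('r idx \<Rightarrow>\<^sub>0 nat) \<Rightarrow>\<^sub>0 'k) fps mat)) i =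
      (\<Sum>p\<in>?P. signof p * fps_nth (\<Prod>j<?r. h_form_series_mat us $$ (p j, j)) i)"
    by (subst det_col[of _ ?r]) (simp_all add: h_form_series_mat_def fps_sum_nth fps_nth_signof_mult)
  also have "\<dots> = (\<Sum>p\<in>?P. signof p *
      (\<Sum>as\<in>natpermute i ?r. \<Prod>j<?r. h_form (p j + as ! j) (us ! j)))"
  proof (intro sum.cong refl arg_cong[where f = "(*) _"])
    fix p assume p: "p \<in> ?P"
    show "fps_nth (\<Prod>j<?r. h_form_series_mat us $$ (p j, j)) i =
        (\<Sum>as\<in>natpermute i ?r. \<Prod>j<?r. (h_form (p j + as ! j) (us ! j) :: ('r idx \<Rightarrow>\<^sub>0 nat) \<Rightarrow>\<^sub>0 'k))"
      unfolding lt fps_prod_nth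
      by (intro sum.cong prod.cong) (use perm[OF p] l in \<open>auto simp: h_form_series_mat_def\<close>)
  qed
  also have "\<dots> = (\<Sum>as\<in>natpermute i ?r. \<Sum>p\<in>?P. signof p * (\<Prod>j<?r. h_form (p j + as ! j) (us ! j)))"
    unfolding sum_distrib_left by (rule sum.swap)
  also have "\<dots> = (\<Sum>as\<in>natpermute i ?r. h_form_det (map2 (\<lambda>a u. monom 1 a * u) as us))"
  proof (rule sum.cong)
    fix as assume "as \<in> natpermute i ?r"
    then have as: "length as = ?r" by (simp add: natpermute_def)
    show "(\<Sum>p\<in>?P. signof p * (\<Prod>j<?r. h_form (p j + as ! j) (us ! j))) =
        (h_form_det (map2 (\<lambda>a u. monom 1 a * u) as us) :: ('r idx \<Rightarrow>\<^sub>0 nat) \<Rightarrow>\<^sub>0 'k)"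
      unfolding h_form_det_def using as us perm
      by (simp add: det_col[of _ ?r] h_form_monom_mult)
  qed simp
  also have "\<dots> = coord (sigma i (wedge us))"
    by (simp add: sigma_wedge coord_hom_rules coord_wedge natpermute_def us conj_commute)
  finally show ?thesis .
qed

lemma det_triangular_prod:
  assumes "A \<in> carrier_mat n n" and "upper_triangular A \<or> upper_triangular (transpose_mat A)"
  shows "det A = (\<Prod>k<n. A $$ (k, k))"
proof -
  have "det B = (\<Prod>k<n. B $$ (k, k))" if "upper_triangular B" "B \<in> carrier_mat n n" for B :: "'a mat"
    using det_upper_triangular[OF that] that(2) by (simp add: prod_list_diag_prod atLeast0LessThan)
  from assms(2) this[of A] this[of "transpose_mat A"] assms(1) show ?thesis
    by (auto simp: det_transpose)
qed

text \<open>
  Let \<open>P\<^sub>k\<close> denote the row of values of the \<open>k\<close>-th form on the \<open>u\<^sub>j\<close>.  The rows \<open>M\<^sub>k = \<Sum>\<^sub>a t\<^sup>a P\<^bsub>k+a\<^esub>\<close> of the matrix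
  of series satisfy \<open>M\<^sub>k - t M\<^bsub>k+1\<^esub> = P\<^sub>k\<close>, and by the recurrence \<open>E\<^sub>r(t) M\<^bsub>r-1\<^esub>\<close> is \<open>P\<^bsub>r-1\<^esub>\<close> plus a
  combination of \<open>P\<^sub>0, \<dots>, P\<^bsub>r-2\<^esub>\<close>.  So \<open>U M = L P\<close> with \<open>U\<close> upper triangular of determinant \<open>E\<^sub>r(t)\<close> and \<open>L\<close>
  lower unitriangular.
\<close>

lemma gen_series_det_h_form_series_mat:
  assumes us: "length us = CARD('r::finite)"
  shows "gen_series * det (h_form_series_mat us) =
    fps_const (h_form_det us :: ('r idx \<Rightarrow>\<^sub>0 nat) \<Rightarrow>\<^sub>0 'k::comm_ring_1)"
proof -
  let ?r = "CARD('r)"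
  obtain l where l: "?r = Suc l" using not0_implies_Suc[of ?r] by auto
  let ?M = "h_form_series_mat us :: (('r idx \<Rightarrow>\<^sub>0 nat) \<Rightarrow>\<^sub>0 'k) fps mat"
  define P where "P = mat ?r ?r (\<lambda>(k, j). fps_const (h_form k (us ! j) :: ('r idx \<Rightarrow>\<^sub>0 nat) \<Rightarrow>\<^sub>0 'k))"
  define U where "U = mat ?r ?r (\<lambda>(k, i). if k = l then (if i = l then gen_series else 0)
     else if i = k then 1 else if i = Suc k then - fps_X else (0 :: (('r idx \<Rightarrow>\<^sub>0 nat) \<Rightarrow>\<^sub>0 'k) fps))"
  \<comment> \<open>The coefficients of the last row of \<open>L\<close>, for \<open>a > 0\<close>: those terms \<open>(-1)\<^sup>j e\<^sub>j P\<^bsub>l+a-j\<^esub>\<close> of the recurrence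
      with \<open>j > a\<close>, which the product \<open>E\<^sub>r(t) M\<^sub>l\<close> lacks at \<open>t\<^sup>a\<close>, with opposite sign\<close>
  define c where "c i a = (if a = 0 then if i = l then 1 else 0 else if i = l then 0
     else - ((-1) ^ (l + a - i) * gen (l + a - i)) :: ('r idx \<Rightarrow>\<^sub>0 nat) \<Rightarrow>\<^sub>0 'k)" for i a
  define L where "L = mat ?r ?r (\<lambda>(k, i). if k = l then Abs_fps (c i)
     else if i = k then 1 else (0 :: (('r idx \<Rightarrow>\<^sub>0 nat) \<Rightarrow>\<^sub>0 'k) fps))"
  have carrier: "?M \<in> carrier_mat ?r ?r" "P \<in> carrier_mat ?r ?r" "U \<in> carrier_mat ?r ?r" "L \<in> carrier_mat ?r ?r"
    by (simp_all add: h_form_series_mat_def P_def U_def L_def)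
  have "U * ?M = L * P"
  proof (rule eq_matI)
    fix k j assume "k < dim_row (L * P)" "j < dim_col (L * P)"
    then have k: "k < Suc l" and j: "j < Suc l" using carrier l by auto
    let ?u = "us ! j"
    have "(U * ?M) $$ (k, j) = (\<Sum>i<Suc l. U $$ (k, i) * Abs_fps (\<lambda>a. h_form (i + a) ?u))"
      using carrier k j l by (simp add: scalar_prod_def h_form_series_mat_def atLeast0LessThan)
    moreover have "(L * P) $$ (k, j) = (\<Sum>i<Suc l. L $$ (k, i) * fps_const (h_form i ?u))"
      using carrier k j l by (simp add: scalar_prod_def P_def atLeast0LessThan)
    moreover have "(\<Sum>i<Suc l. U $$ (k, i) * Abs_fps (\<lambda>a. h_form (i + a) ?u)) =
        (\<Sum>i<Suc l. L $$ (k, i) * fps_const (h_form i ?u))"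
    proof (cases "k = l")
      case False
      have "(\<Sum>i<Suc l. U $$ (k, i) * Abs_fps (\<lambda>a. h_form (i + a) ?u)) =
          (\<Sum>i\<in>{k, Suc k}. U $$ (k, i) * Abs_fps (\<lambda>a. h_form (i + a) ?u))"
        by (rule sum.mono_neutral_right) (use k False l in \<open>auto simp: U_def\<close>)
      also have "\<dots> = Abs_fps (\<lambda>a. h_form (k + a) ?u) - fps_X * Abs_fps (\<lambda>a. h_form (Suc k + a) ?u)"
        using k False l by (simp add: U_def)
      also have "\<dots> = fps_const (h_form k ?u)"
        by (rule fps_ext) (auto simp: fps_X_mult_nth)
      also have "\<dots> = (\<Sum>i\<in>{k}. L $$ (k, i) * fps_const (h_form i ?u))"
        using k False l by (simp add: L_def)
      also have "\<dots> = (\<Sum>i<Suc l. L $$ (k, i) * fps_const (h_form i ?u))"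
        by (rule sum.mono_neutral_left) (use k False l in \<open>auto simp: L_def\<close>)
      finally show ?thesis .
    next
      case True
      have "(\<Sum>i<Suc l. U $$ (k, i) * Abs_fps (\<lambda>a. h_form (i + a) ?u)) =
          gen_series * Abs_fps (\<lambda>a. h_form (l + a) ?u)"
        using True l by (simp add: U_def)
      also have "\<dots> = (\<Sum>i<Suc l. Abs_fps (c i) * fps_const (h_form i ?u))"
      proof (rule fps_ext)
        fix a
        let ?t = "\<lambda>i. (-1) ^ i * gen i * (h_form (l + a - i) ?u :: ('r idx \<Rightarrow>\<^sub>0 nat) \<Rightarrow>\<^sub>0 'k)"
        have lhs: "fps_nth (gen_series * Abs_fps (\<lambda>a. h_form (l + a) ?u)) a = sum ?t {..a}"
          unfolding fps_mult_nth atLeast0AtMost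
          by (rule sum.cong) (auto simp: gen_series_def)
        have rhs: "fps_nth (\<Sum>i<Suc l. Abs_fps (c i) * fps_const (h_form i ?u)) a =
            (\<Sum>i<l. c i a * h_form i ?u) + c l a * h_form l ?u"
          by (simp add: fps_sum_nth)
        show "fps_nth (gen_series * Abs_fps (\<lambda>a. h_form (l + a) ?u)) a =
            fps_nth (\<Sum>i<Suc l. Abs_fps (c i) * fps_const (h_form i ?u)) a"
        proof (cases "a = 0")
          case True
          then show ?thesis unfolding lhs rhs by (simp add: c_def gen_def)
        next
          case False
          have "sum ?t {..a} + sum ?t {a<..l + a} = sum ?t {..l + a}"
            by (subst sum.union_disjoint[symmetric]) (auto intro: sum.cong)
          also have "\<dots> = 0"
            using h_form_recurrence[where 'r='r, of a ?u] False l by simp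
          finally have "sum ?t {..a} = - sum ?t {a<..l + a}"
            by (simp only: eq_neg_iff_add_eq_0)
          also have "\<dots> = (\<Sum>i<l. c i a * h_form i ?u)"
            unfolding sum_negf[symmetric] using False
            by (intro sum.reindex_bij_witness[of _ "\<lambda>i. l + a - i" "\<lambda>i. l + a - i"])
              (auto simp: c_def)
          finally show ?thesis
            unfolding lhs rhs using False by (simp add: c_def)
        qed
      qed
      also have "\<dots> = (\<Sum>i<Suc l. L $$ (k, i) * fps_const (h_form i ?u))"
        using True l by (simp add: L_def)
      finally show ?thesis .
    qed
    ultimately show "(U * ?M) $$ (k, j) = (L * P) $$ (k, j)" by simp
  qed (use carrier in auto)
  then have "det U * det ?M = det L * det P"
    using det_mult[OF carrier(3,1)] det_mult[OF carrier(4,2)] by simp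
  moreover have "det U = (\<Prod>k<?r. U $$ (k, k))"
    by (rule det_triangular_prod[OF carrier(3)]) (auto simp: U_def upper_triangular_def)
  then have "det U = gen_series" unfolding l by (simp add: U_def l)
  moreover have "det L = (\<Prod>k<?r. L $$ (k, k))"
    by (rule det_triangular_prod[OF carrier(4)]) (auto simp: L_def l upper_triangular_def)
  then have "det L = 1" unfolding l by (simp add: L_def l c_def fps_eq_iff)
  moreover have "det P = fps_const (h_form_det us)"
  proof -
    interpret comm_ring_hom "fps_const :: (('r idx \<Rightarrow>\<^sub>0 nat) \<Rightarrow>\<^sub>0 'k) \<Rightarrow> _"
      by standard auto
    have "P = map_mat fps_const (mat ?r ?r (\<lambda>(k, j). h_form k (us ! j)))"
      by (rule eq_matI) (auto simp: P_def)
    then show ?thesis using us by (simp add: h_form_det_def)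
  qed
  ultimately show ?thesis by simp
qed

lemma coord_sigma:
  assumes "x \<in> ext_deg CARD('r::finite)"
  shows "coord (sigma i x) = fps_nth gen_series_inv i * (coord x :: ('r idx \<Rightarrow>\<^sub>0 nat) \<Rightarrow>\<^sub>0 'k::comm_ring_1)"
  using assms
proof (induct rule: ext_deg_induct)
  case (wedge us)
  let ?M = "h_form_series_mat us :: (('r idx \<Rightarrow>\<^sub>0 nat) \<Rightarrow>\<^sub>0 'k) fps mat"
  have "det ?M = gen_series_inv * (gen_series * det ?M)"
    by (simp add: mult.assoc[symmetric] mult.commute[of gen_series_inv] gen_series_inv)
  then show ?case
    using det_h_form_series_mat_nth[OF wedge, of i]
    by (simp add: gen_series_det_h_form_series_mat[OF wedge] coord_wedge)
qed (simp_all add: ext_hom_rules coord_hom_rules distrib_left mult.left_commute)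

lemma gen_Suc:
  "(gen (Suc n) :: ('r::finite idx \<Rightarrow>\<^sub>0 nat) \<Rightarrow>\<^sub>0 'k::comm_ring_1) =
    (\<Sum>j\<le>n. (-1) ^ j * fps_nth gen_series_inv (Suc j) * gen (n - j))"
proof -
  let ?h = "fps_nth (gen_series_inv :: (('r idx \<Rightarrow>\<^sub>0 nat) \<Rightarrow>\<^sub>0 'k) fps)"
  have sgn: "(-1) ^ Suc n * (-1) ^ (Suc n - j) = (-1 :: ('r idx \<Rightarrow>\<^sub>0 nat) \<Rightarrow>\<^sub>0 'k) ^ j" if "j \<le> Suc n" for j
    using that by (metis le_add_diff_inverse left_minus_one_mult_self mult.commute power_add)
  have "0 = (-1) ^ Suc n * fps_nth (gen_series_inv * gen_series :: (('r idx \<Rightarrow>\<^sub>0 nat) \<Rightarrow>\<^sub>0 'k) fps) (Suc n)"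
    by (simp add: mult.commute[of gen_series_inv] gen_series_inv)
  also have "\<dots> = (\<Sum>j\<le>Suc n. (-1) ^ Suc n * (-1) ^ (Suc n - j) * (?h j * gen (Suc n - j)))"
    unfolding fps_mult_nth atLeast0AtMost sum_distrib_left
    by (rule sum.cong) (simp_all add: gen_series_def mult_ac)
  also have "\<dots> = (\<Sum>j\<le>Suc n. (-1) ^ j * (?h j * gen (Suc n - j)))"
    by (rule sum.cong) (simp_all only: sgn atMost_iff)
  also have "\<dots> = gen (Suc n) - (\<Sum>j\<le>n. (-1) ^ j * ?h (Suc j) * gen (n - j))"
    unfolding sum.atMost_Suc_shift by (simp add: gen_series_inv_def sum_negf mult.assoc)
  finally show ?thesis by simp
qed

lemma coord_ext_e:
  assumes "x \<in> ext_deg CARD('r::finite)"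
  shows "coord (ext_e i x) = gen i * (coord x :: ('r idx \<Rightarrow>\<^sub>0 nat) \<Rightarrow>\<^sub>0 'k::comm_ring_1)"
proof (induct i rule: less_induct)
  case (less i)
  show ?case
  proof (cases i)
    case 0
    then show ?thesis by (simp add: gen_def)
  next
    case (Suc n)
    have "coord (ext_e i x) = (\<Sum>j\<le>n. base ((-1) ^ j) * (fps_nth gen_series_inv (Suc j) *
        (gen (n - j) * (coord x :: ('r idx \<Rightarrow>\<^sub>0 nat) \<Rightarrow>\<^sub>0 'k))))"
      unfolding Suc ext_e.simps coord_hom_rules
      by (intro sum.cong) (simp_all add: coord_sigma ext_e_ext_deg assms less Suc)
    moreover have "base ((-1) ^ j) = (-1 :: ('r idx \<Rightarrow>\<^sub>0 nat) \<Rightarrow>\<^sub>0 'k) ^ j" for j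
      by (induct j) (simp_all add: base_simps)
    ultimately show ?thesis
      unfolding Suc gen_Suc[of n] by (simp add: sum_distrib_right mult.assoc)
  qed
qed

text \<open>
  By \<open>coord_sigma\<close> the form \<open>coord\<close> turns \<open>\<sigma>\<^sub>i\<close> into multiplication by \<open>h\<^sub>i\<close>, hence, the \<open>e\<^sub>i\<close> being the same
  polynomials in the \<open>h\<^sub>j\<close> as the operators are in the \<open>\<sigma>\<^sub>j\<close>, also \<open>e\<^sub>i\<close> into multiplication by \<open>e\<^sub>i\<close>.
\<close>

lemma coord_act:
  assumes "x \<in> ext_deg CARD('r::finite)"
  shows "coord (act b x) = b * (coord x :: ('r idx \<Rightarrow>\<^sub>0 nat) \<Rightarrow>\<^sub>0 'k::comm_ring_1)"
  using assms
  by (induct b arbitrary: x rule: mpoly_induct)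
    (simp_all add: act_base act_gen_eq act_add_left act_mult act_ext_deg coord_hom_rules coord_ext_e
      distrib_right mult.assoc)

lemma coord_delta_wedge: "coord (delta_wedge CARD('r)) = (1 :: ('r::finite idx \<Rightarrow>\<^sub>0 nat) \<Rightarrow>\<^sub>0 'k::comm_ring_1)"
proof -
  let ?r = "CARD('r)"
  let ?A = "mat ?r ?r (\<lambda>(k, j). h_int (int k - int j) :: ('r idx \<Rightarrow>\<^sub>0 nat) \<Rightarrow>\<^sub>0 'k)"
  have "mat ?r ?r (\<lambda>(k, j). h_form k (map (monom 1) (rev [0..<?r]) ! j)) = ?A"
    by (rule eq_matI) (auto simp: h_form_monom rev_nth of_nat_diff)
  then have "coord (delta_wedge ?r) = det ?A"
    unfolding delta_wedge_def coord_wedge h_form_det_def by simp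
  also have "\<dots> = (\<Prod>k<?r. ?A $$ (k, k))"
    by (rule det_triangular_prod) (auto simp: upper_triangular_def h_int_def)
  also have "\<dots> = 1"
    by (simp add: h_int_def gen_series_inv_def)
  finally show ?thesis .
qed

text \<open>
  A \<open>b\<close> exists by \<open>ext_deg_generated\<close>, and applying the linear form \<open>coord\<close>, which is \<open>1\<close> on the generator,
  recovers it.
\<close>

theorem ext_deg_free:
  assumes "x \<in> ext_deg CARD('r::finite)"
  shows "x = act (b :: ('r idx \<Rightarrow>\<^sub>0 nat) \<Rightarrow>\<^sub>0 'k::comm_ring_1) (delta_wedge CARD('r)) \<longleftrightarrow> b = coord x"
proof
  have coord: "coord (act c (delta_wedge CARD('r))) = c" for c :: "('r idx \<Rightarrow>\<^sub>0 nat) \<Rightarrow>\<^sub>0 'k"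
    by (simp add: coord_act delta_wedge_ext_deg coord_delta_wedge)
  show "b = coord x" if "x = act b (delta_wedge CARD('r))"
    using that coord by simp
  obtain c :: "('r idx \<Rightarrow>\<^sub>0 nat) \<Rightarrow>\<^sub>0 'k" where "x = act c (delta_wedge CARD('r))"
    using ext_deg_generated[OF assms] by blast
  then show "x = act b (delta_wedge CARD('r))" if "b = coord x"
    using that coord by simp
qed

section \<open>The determinantal formula and the star action\<close>

lemma h_form_sum: "h_form k (sum f A) = (\<Sum>a\<in>A. h_form k (f a))"
  by (induct A rule: infinite_finite_induct) (simp_all add: h_form_add h_form_def[of k 0] base_simps)

text \<open>
  Passing from \<open>X\<^sup>m\<close> to \<open>X\<^sup>m(c)\<close> multiplies the generating series of the \<open>h\<^sub>j\<close> by \<open>\<c>(z)\<close>.  In row \<open>k < r\<close> the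
  index is at most \<open>m\<close>, so the truncation in the definition of \<open>X\<^sup>m(c)\<close> loses no term.
\<close>

lemma h_form_Xc:
  assumes "k < CARD('r)"
  shows "h_form k (Xc m) = (h_c (int m + int k + 1 - int CARD('r)) :: ('n::finite, 'r::finite) Br)"
proof -
  let ?z = "int m + int k + 1 - int CARD('r)"
  let ?t = "\<lambda>i. base (fps_nth gen_series i) * (h_int (?z - int i) :: ('n, 'r) Br)"
  have "(Xc m :: 'n B0 poly) = (\<Sum>i\<le>m. smult (fps_nth gen_series i) (monom 1 (m - i)))"
    by (simp add: Xc_def gen_series_def smult_monom)
  then have "h_form k (Xc m) = (\<Sum>i\<le>m. base (fps_nth gen_series i) * (h_form k (monom 1 (m - i)) :: ('n, 'r) Br))"
    by (simp only: h_form_sum h_form_smult)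
  also have "\<dots> = sum ?t {..m}"
    by (rule sum.cong) (auto simp: h_form_monom of_nat_diff algebra_simps)
  also have "\<dots> = h_c ?z"
  proof (cases "?z < 0")
    case True
    then show ?thesis by (simp add: h_int_def h_c_def)
  next
    case False
    have "sum ?t {..m} = sum ?t {..nat ?z}"
      by (rule sum.mono_neutral_right) (use False assms in \<open>auto simp: h_int_def\<close>)
    also have "\<dots> = h_c ?z"
      using False unfolding h_c_def fps_mult_nth atLeast0AtMost
      by (auto intro!: sum.cong simp: h_int_def c_series_def nat_diff_distrib')
    finally show ?thesis .
  qed
  finally show ?thesis .
qed

lemma coord_wedge_Xc:
  assumes "length ns = CARD('r)"
  shows "coord (wedge (map Xc ns)) =
    det (mat CARD('r) CARD('r) (\<lambda>(k, j). h_c (int (ns ! j) + int k + 1 - int CARD('r))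
      :: ('n::finite, 'r::finite) Br))"
  unfolding coord_wedge h_form_det_def using assms
  by (auto intro!: arg_cong[of _ _ det] eq_matI simp: h_form_Xc)

lemma coord_X_wedge:
  assumes "length lam = CARD('r)"
  shows "coord (X_wedge lam) = (Delta lam :: ('n::finite, 'r::finite) Br)"
proof -
  have X: "X_wedge lam = wedge (map Xc (map (\<lambda>j. CARD('r) - 1 - j + lam ! j) [0..<CARD('r)]))"
    by (simp add: X_wedge_def assms comp_def)
  show ?thesis
    unfolding X Delta_def
    by (subst coord_wedge_Xc) (auto intro!: arg_cong[of _ _ det] eq_matI arg_cong[of _ _ h_c] simp: of_nat_diff)
qed

lemma X_wedge_ext_deg: "X_wedge lam \<in> ext_deg (length lam)"
  unfolding X_wedge_def by (rule ext_deg_wedge) simp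

lemma Delta_empty: "Delta (replicate CARD('r) 0) = (1 :: ('n::finite, 'r::finite) Br)"
proof -
  let ?r = "CARD('r)"
  let ?A = "mat ?r ?r (\<lambda>(k, j). h_c (int (replicate ?r (0 :: nat) ! j) - int j + int k) :: ('n, 'r) Br)"
  have "det ?A = (\<Prod>k<?r. ?A $$ (k, k))"
    by (rule det_triangular_prod) (auto simp: upper_triangular_def h_c_def)
  also have "\<dots> = 1"
    by (simp add: h_c_def c_series_def gen_series_def gen_series_inv_def gen_def base_simps)
  finally show ?thesis unfolding Delta_def .
qed

lemma X_wedge_empty:
  "X_wedge (replicate CARD('r::finite) 0) = (delta_wedge CARD('r) :: 'n::finite B0 ext)"
  using ext_deg_free[of "X_wedge (replicate CARD('r) 0)" "1 :: ('n, 'r) Br"]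
    X_wedge_ext_deg[of "replicate CARD('r) 0"]
  by (simp add: coord_X_wedge Delta_empty act_1)

theorem giambelli_formula:
  assumes "length lam = CARD('r)"
  shows "X_wedge lam = act (Delta lam :: ('n::finite, 'r::finite) Br) (X_wedge (replicate CARD('r) 0))"
  unfolding X_wedge_empty
  using ext_deg_free[of "X_wedge lam" "Delta lam :: ('n, 'r) Br"] X_wedge_ext_deg[of lam] assms
  by (simp add: coord_X_wedge)

lemma contract_ext_deg:
  assumes "\<And>u v. \<phi> (u + v) = \<phi> u + \<phi> v" "\<And>a u. \<phi> (smult a u) = a * \<phi> u"
    and "x \<in> ext_deg m"
  shows "contract \<phi> x \<in> ext_deg (m - 1)"
proof -
  interpret C: module_hom ext_scale ext_scale "contract \<phi>"
    using assms(1,2) by (rule contract_hom)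
  from assms(3) show ?thesis
  proof (induct rule: ext_deg_induct)
    case (wedge us)
    show ?case
      unfolding contract_wedge[of \<phi>, OF assms(1,2)]
      by (intro ext_deg_closed ext_deg_wedge) (use wedge in auto)
  qed (auto simp: C.add C.scale intro: ext_deg_closed)
qed

text \<open>
  The operation \<open>\<star>\<close> is given \<open>\<Delta>\<^sub>\<lambda>\<close> rather than \<open>\<lambda>\<close>.  Whether or not \<open>\<Delta>\<^sub>\<lambda>\<close> determines \<open>\<lambda>\<close>, it determines
  \<open>[X(c)]\<^sub>\<lambda> = \<Delta>\<^sub>\<lambda> [X(c)]\<^sub>0\<close>, which is all that the result depends on.
\<close>

lemma star_eq:
  fixes \<phi> :: "'n::finite B0 poly \<Rightarrow> 'n B0"
  assumes "\<And>u v. \<phi> (u + v) = \<phi> u + \<phi> v" "\<And>a u. \<phi> (smult a u) = a * \<phi> u"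
    and lam: "is_partition CARD('r) lam"
  shows "star f \<phi> (Delta lam) = (coord (wedge_left f (contract \<phi> (X_wedge lam))) :: ('n, 'r::finite) Br)"
proof -
  let ?r = "CARD('r)"
  let ?x = "wedge_left f (contract \<phi> (X_wedge lam))"
  have len: "length lam = ?r" using lam by (simp add: is_partition_def)
  have "contract \<phi> (X_wedge lam) \<in> ext_deg (?r - 1)"
    using contract_ext_deg[of \<phi>, OF assms(1,2)] X_wedge_ext_deg len by metis
  then have x: "?x \<in> ext_deg ?r"
    using wedge_left_ext_deg by fastforce
  have iff: "act b (X_wedge (replicate ?r 0)) = ?x \<longleftrightarrow> b = coord ?x" for b :: "('n, 'r) Br"
    unfolding X_wedge_empty using ext_deg_free[OF x, of b] by auto
  have X: "X_wedge mu = (X_wedge lam :: 'n B0 ext)"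
    if "is_partition ?r mu" "Delta lam = (Delta mu :: ('n, 'r) Br)" for mu
    using that giambelli_formula[of mu, where 'n='n and 'r='r] giambelli_formula[OF len, where 'n='n]
    by (simp add: is_partition_def)
  show ?thesis
    unfolding star_def
  proof (rule the_equality)
    show "\<exists>mu. is_partition ?r mu \<and> Delta lam = (Delta mu :: ('n, 'r) Br) \<and>
        act (coord ?x :: ('n, 'r) Br) (X_wedge (replicate ?r 0)) = wedge_left f (contract \<phi> (X_wedge mu))"
      using lam iff by blast
  next
    fix b :: "('n, 'r) Br"
    assume "\<exists>mu. is_partition ?r mu \<and> Delta lam = (Delta mu :: ('n, 'r) Br) \<and>
        act b (X_wedge (replicate ?r 0)) = wedge_left f (contract \<phi> (X_wedge mu))"
    then show "b = coord ?x" using X iff by metis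
  qed
qed

text \<open>
  Each term of the contraction is a wedge of elements \<open>X\<^sup>n(c)\<close>, with coordinate a determinant whose
  first column comes from \<open>X\<^sup>i(c)\<close>.  It is expanded along this column, the only one that depends
  on \<open>i\<close>, in preparation for summing over \<open>i\<close>.
\<close>

lemma star_Xc_eq:
  fixes \<phi> :: "'n::finite B0 poly \<Rightarrow> 'n B0" and lam :: "nat list"
  defines "m \<equiv> (\<lambda>j. CARD('r) - 1 - j + lam ! j)"
  assumes "\<And>u v. \<phi> (u + v) = \<phi> u + \<phi> v" "\<And>a u. \<phi> (smult a u) = a * \<phi> u"
    and lam: "is_partition CARD('r) lam"
  shows "star (Xc i) \<phi> (Delta lam) =
    (\<Sum>q<CARD('r). (-1) ^ q * base (\<phi> (Xc (m q))) *
      (\<Sum>k<CARD('r). (-1) ^ k * h_c (int i + int k + 1 - int CARD('r)) *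
        det (mat (CARD('r) - 1) (CARD('r) - 1) (\<lambda>(k', j).
          h_c (int (m (if j < q then j else Suc j)) + int (if k' < k then k' else Suc k') + 1 - int CARD('r))
          :: ('n, 'r::finite) Br))))"
proof -
  let ?r = "CARD('r)"
  let ?ns = "map m [0..<?r]"
  have len: "length lam = ?r" using lam by (simp add: is_partition_def)
  have X: "X_wedge lam = wedge (map Xc ?ns)"
    by (simp add: X_wedge_def len m_def comp_def)
  have sgn: "base ((-1) ^ q) = (-1 :: ('n, 'r) Br) ^ q" for q
    by (induct q) (simp_all add: base_simps)
  have minor: "coord (wedge (map Xc (i # take q ?ns @ drop (Suc q) ?ns))) =
      (\<Sum>k<?r. (-1) ^ k * h_c (int i + int k + 1 - int ?r) *
        det (mat (?r - 1) (?r - 1) (\<lambda>(k', j).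
          h_c (int (m (if j < q then j else Suc j)) + int (if k' < k then k' else Suc k') + 1 - int ?r)
          :: ('n, 'r) Br)))" if q: "q < ?r" for q
  proof -
    let ?ms = "take q ?ns @ drop (Suc q) ?ns"
    have nth: "?ms ! j = m (if j < q then j else Suc j)" if "j < ?r - 1" for j
      using that q by (auto simp: nth_append)
    have l: "length ([] @ i # ?ms) = ?r" using q by simp
    have "coord (wedge (map Xc ([] @ i # ?ms))) =
        det (mat ?r ?r (\<lambda>(k, j). h_c (int (([] @ i # ?ms) ! j) + int k + 1 - int ?r) :: ('n, 'r) Br))"
      using l by (rule coord_wedge_Xc)
    also have "\<dots> = (\<Sum>k<?r. h_c (int i + int k + 1 - int ?r) * ((-1) ^ (k + length ([] :: nat list)) *
        det (mat (?r - 1) (?r - 1) (\<lambda>(k', j).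
          h_c (int (([] @ ?ms) ! j) + int (if k' < k then k' else Suc k') + 1 - int ?r) :: ('n, 'r) Br))))"
      by (rule det_expand_along_entry[OF l, where G = "\<lambda>k a. h_c (int a + int k + 1 - int ?r)"])
    also have "\<dots> = (\<Sum>k<?r. (-1) ^ k * h_c (int i + int k + 1 - int ?r) *
        det (mat (?r - 1) (?r - 1) (\<lambda>(k', j).
          h_c (int (m (if j < q then j else Suc j)) + int (if k' < k then k' else Suc k') + 1 - int ?r)
          :: ('n, 'r) Br)))"
    proof (rule sum.cong)
      fix k
      have "mat (?r - 1) (?r - 1) (\<lambda>(k', j).
          h_c (int (([] @ ?ms) ! j) + int (if k' < k then k' else Suc k') + 1 - int ?r) :: ('n, 'r) Br) =
        mat (?r - 1) (?r - 1) (\<lambda>(k', j).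
          h_c (int (m (if j < q then j else Suc j)) + int (if k' < k then k' else Suc k') + 1 - int ?r))"
        by (rule eq_matI) (simp_all only: index_mat dim_row_mat dim_col_mat case_prod_conv append_Nil nth)
      then show "h_c (int i + int k + 1 - int ?r) * ((-1) ^ (k + length ([] :: nat list)) *
        det (mat (?r - 1) (?r - 1) (\<lambda>(k', j).
          h_c (int (([] @ ?ms) ! j) + int (if k' < k then k' else Suc k') + 1 - int ?r) :: ('n, 'r) Br))) =
        (-1) ^ k * h_c (int i + int k + 1 - int ?r) *
        det (mat (?r - 1) (?r - 1) (\<lambda>(k', j).
          h_c (int (m (if j < q then j else Suc j)) + int (if k' < k then k' else Suc k') + 1 - int ?r)))"
        by (simp only: list.size add_0_right mult.left_commute mult.assoc)
    qed simp
    finally show ?thesis by simp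
  qed
  have "star (Xc i) \<phi> (Delta lam) = (coord (wedge_left (Xc i) (contract \<phi> (X_wedge lam))) :: ('n, 'r) Br)"
    using assms(2-4) by (rule star_eq)
  also have "\<dots> = (\<Sum>q<?r. (-1) ^ q * base (\<phi> (Xc (m q))) *
      coord (wedge (map Xc (i # take q ?ns @ drop (Suc q) ?ns))))"
    unfolding X contract_wedge[of \<phi>, OF assms(2,3)] ext_hom_rules coord_hom_rules
    by (simp add: wedge_left_wedge base_simps sgn take_map drop_map)
  also have "\<dots> = (\<Sum>q<?r. (-1) ^ q * base (\<phi> (Xc (m q))) *
      (\<Sum>k<?r. (-1) ^ k * h_c (int i + int k + 1 - int ?r) *
        det (mat (?r - 1) (?r - 1) (\<lambda>(k', j).
          h_c (int (m (if j < q then j else Suc j)) + int (if k' < k then k' else Suc k') + 1 - int ?r)))))"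
    by (rule sum.cong) (simp_all only: minor lessThan_iff)
  finally show ?thesis .
qed

section \<open>Generating functions in two variables\<close>

lemma fls_const_sum: "fls_const (sum f A) = (\<Sum>a\<in>A. fls_const (f a))"
  by (induct A rule: infinite_finite_induct) (simp_all flip: fls_plus_const)

lemma scalar_simps:
  "scalar 0 = 0" "scalar 1 = 1" "scalar (a + b) = scalar a + scalar b"
  "scalar (a * b) = scalar a * scalar b" "scalar (- a) = - scalar a" "scalar (a ^ k) = scalar a ^ k"
  by (simp_all add: scalar_def fls_plus_const fls_const_power)

lemma scalar_det: "scalar (det A) = det (map_mat scalar A)"
proof -
  interpret comm_ring_hom "scalar :: 'a \<Rightarrow> _"
    by standard (simp_all add: scalar_simps)
  show ?thesis by simp
qed

lemma in_z_mult: "in_z (f * g) = in_z f * in_z g"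
proof -
  have "Abs_fps (\<lambda>i. fls_const (fps_nth (f * g) i)) =
      Abs_fps (\<lambda>i. fls_const (fps_nth f i)) * Abs_fps (\<lambda>i. fls_const (fps_nth g i))"
    by (rule fps_ext) (simp add: fps_mult_nth fls_const_sum)
  then show ?thesis by (simp add: in_z_def fls_times_fps_to_fls)
qed

lemma zvar_pow_mult_in_z:
  assumes "k \<le> l"
  shows "zvar ^ l * (in_z F * zvar_inv ^ k) =
    in_z (Abs_fps (\<lambda>i. if l \<le> i + k then fps_nth F (i + k - l) else 0))"
proof -
  have "zvar ^ l * (in_z F * zvar_inv ^ k) = fls_shift (int k - int l) (in_z F)"
    by (simp add: zvar_def zvar_inv_def fls_X_power_times_conv_shift fls_X_inv_power_times_conv_shift)
  also have "\<dots> = in_z (Abs_fps (\<lambda>i. if l \<le> i + k then fps_nth F (i + k - l) else 0))"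
  proof (rule fls_eqI)
    fix i
    have "nat (i + (int k - int l)) = nat i + k - l" if "0 \<le> i" using that by linarith
    then show "fls_nth (fls_shift (int k - int l) (in_z F)) i =
        fls_nth (in_z (Abs_fps (\<lambda>i. if l \<le> i + k then fps_nth F (i + k - l) else 0))) i"
      using assms by (auto simp: in_z_def)
  qed
  finally show ?thesis .
qed

text \<open>
  The row operation is left multiplication by a lower unitriangular bidiagonal matrix.
\<close>

lemma det_row_difference:
  fixes F :: "nat \<Rightarrow> nat \<Rightarrow> 'a::comm_ring_1"
  shows "det (mat n n (\<lambda>(k, j). F k j - (if k = 0 then 0 else t * F (k - 1) j))) =
    det (mat n n (\<lambda>(k, j). F k j))"
proof -
  let ?B = "mat n n (\<lambda>(k, j). F k j)"
  let ?C = "mat n n (\<lambda>(k, j). F k j - (if k = 0 then 0 else t * F (k - 1) j))"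
  let ?T = "mat n n (\<lambda>(k, i). if i = k then 1 else if k = Suc i then - t else 0)"
  have "?T * ?B = ?C"
  proof (rule eq_matI)
    fix k j assume "k < dim_row ?C" "j < dim_col ?C"
    then have kj: "k < n" "j < n" by auto
    then have "(?T * ?B) $$ (k, j) = (\<Sum>i<n. (if i = k then 1 else if k = Suc i then - t else 0) * F i j)"
      by (simp add: scalar_prod_def atLeast0LessThan)
    also have "\<dots> = (\<Sum>i\<in>{k, k - 1}. (if i = k then 1 else if k = Suc i then - t else 0) * F i j)"
      by (rule sum.mono_neutral_right) (use kj in auto)
    also have "\<dots> = ?C $$ (k, j)"
      using kj by (cases k) auto
    finally show "(?T * ?B) $$ (k, j) = ?C $$ (k, j)" .
  qed auto
  moreover have "det ?T = (\<Prod>k<n. ?T $$ (k, k))"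
    by (rule det_triangular_prod) (auto simp: upper_triangular_def)
  then have "det ?T = 1" by simp
  moreover have "det (?T * ?B) = det ?T * det ?B"
    by (rule det_mult[of _ n]) auto
  ultimately show ?thesis by simp
qed

text \<open>
  Both sides compute the determinant of size \<open>l + 1\<close> with the entries \<open>h\<^bsub>n\<^sub>j + k\<^esub>(c)\<close> and an additional first
  column \<open>1, z\<^sup>-\<^sup>1, z\<^sup>-\<^sup>2, \<dots>\<close>.  The right hand side is its expansion along this column.  Subtracting from
  each row \<open>z\<^sup>-\<^sup>1\<close> times the row above reduces the column to its top entry \<open>1\<close> and produces the left
  hand side as the minor.
\<close>

lemma det_sigma_bar_h:
  fixes n :: "nat \<Rightarrow> int"
  shows "det (mat l l (\<lambda>(k, j). sigma_bar_h (n j + int k + 1) :: ('n::finite, 'r::finite) Br fls fls)) =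
    (\<Sum>k<Suc l. zvar_inv ^ k * ((-1) ^ k *
      scalar (det (mat l l (\<lambda>(k', j). h_c (n j + int (if k' < k then k' else Suc k')))))))"
proof -
  \<comment> \<open>The columns of the enlarged matrix, as functions of the row index\<close>
  let ?u = "\<lambda>k. zvar_inv ^ k :: ('n, 'r) Br fls fls"
  let ?vs = "map (\<lambda>j k. scalar (h_c (n j + int k))) [0..<l] :: (nat \<Rightarrow> ('n, 'r) Br fls fls) list"
  let ?xs = "[] @ ?u # ?vs"
  define G where "G k f = f k - (if k = 0 then 0 else zvar_inv * f (k - 1))"
    for k and f :: "nat \<Rightarrow> ('n, 'r) Br fls fls"
  have len: "length ?xs = Suc l" by simp
  have "det (mat (Suc l) (Suc l) (\<lambda>(k, j). (?xs ! j) k)) =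
      (\<Sum>k<Suc l. zvar_inv ^ k * ((-1) ^ k *
        det (mat l l (\<lambda>(k', j). (?vs ! j) (if k' < k then k' else Suc k')))))"
    using det_expand_along_entry[OF len, where G = "\<lambda>k f. f k"] by simp
  also have "\<dots> = (\<Sum>k<Suc l. zvar_inv ^ k * ((-1) ^ k *
      scalar (det (mat l l (\<lambda>(k', j). h_c (n j + int (if k' < k then k' else Suc k')))))))"
    unfolding scalar_det
    by (intro sum.cong refl arg_cong[where f = "(*) _"] arg_cong[of _ _ det] eq_matI) auto
  finally have expand: "det (mat (Suc l) (Suc l) (\<lambda>(k, j). (?xs ! j) k)) = \<dots>" .
  have "det (mat (Suc l) (Suc l) (\<lambda>(k, j). (?xs ! j) k)) =
      det (mat (Suc l) (Suc l) (\<lambda>(k, j). G k (?xs ! j)))"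
    unfolding G_def by (rule det_row_difference[symmetric])
  also have "\<dots> = (\<Sum>k<Suc l. G k ?u * ((-1) ^ k *
      det (mat l l (\<lambda>(k', j). G (if k' < k then k' else Suc k') (?vs ! j)))))"
    using det_expand_along_entry[OF len, where G = G] by simp
  also have "\<dots> = (\<Sum>k<Suc l. if k = 0 then
      det (mat l l (\<lambda>(k', j). G (Suc k') (?vs ! j))) else 0)"
  proof (rule sum.cong)
    fix k
    have "G k ?u = (if k = 0 then 1 else 0)"
      by (cases k) (simp_all add: G_def)
    then show "G k ?u * ((-1) ^ k * det (mat l l (\<lambda>(k', j). G (if k' < k then k' else Suc k') (?vs ! j)))) =
        (if k = 0 then det (mat l l (\<lambda>(k', j). G (Suc k') (?vs ! j))) else 0)"
      by simp
  qed simp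
  also have "\<dots> = det (mat l l (\<lambda>(k', j). G (Suc k') (?vs ! j)))"
    by (simp add: sum.delta)
  also have "\<dots> = det (mat l l (\<lambda>(k, j). sigma_bar_h (n j + int k + 1)))"
    by (intro arg_cong[of _ _ det] eq_matI) (auto simp: G_def sigma_bar_h_def algebra_simps)
  finally show ?thesis using expand by simp
qed

text \<open>
  The factor \<open>z\<^sup>l \<c>(z)/E\<^sub>r(z)\<close> turns the entry \<open>z\<^sup>-\<^sup>k\<close> of the additional column into the generating series of
  the \<open>h\<^bsub>i+k-l\<^esub>(c)\<close> over \<open>i \<ge> 0\<close>.  No term of \<open>\<c>(z)/E\<^sub>r(z)\<close> is cut off, because \<open>k \<le> l\<close>.
\<close>

lemma zvar_in_z_det_sigma_bar_h:
  fixes n :: "nat \<Rightarrow> int"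
  shows "zvar ^ l * in_z (c_series * gen_series_inv) *
      det (mat l l (\<lambda>(k, j). sigma_bar_h (n j + int k + 1) :: ('n::finite, 'r::finite) Br fls fls)) =
    (\<Sum>k<Suc l. in_z (Abs_fps (\<lambda>i. h_c (int i + int k - int l))) * scalar ((-1) ^ k *
      det (mat l l (\<lambda>(k', j). h_c (n j + int (if k' < k then k' else Suc k'))))))"
  unfolding det_sigma_bar_h sum_distrib_left
proof (rule sum.cong)
  fix k assume "k \<in> {..<Suc l}"
  then have k: "k \<le> l" by simp
  let ?H = "c_series * gen_series_inv :: ('n, 'r) Br fps"
  have "Abs_fps (\<lambda>i. if l \<le> i + k then fps_nth ?H (i + k - l) else 0) =
      Abs_fps (\<lambda>i. h_c (int i + int k - int l))"
    by (rule fps_ext) (auto simp: h_c_def nat_diff_distrib' nat_add_distrib)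
  then have z: "zvar ^ l * (in_z ?H * zvar_inv ^ k) = in_z (Abs_fps (\<lambda>i. h_c (int i + int k - int l)))"
    using zvar_pow_mult_in_z[OF k, of ?H] by simp
  have "zvar ^ l * in_z ?H * (zvar_inv ^ k * ((-1) ^ k * a)) =
      zvar ^ l * (in_z ?H * zvar_inv ^ k) * ((-1) ^ k * a)" for a
    by (simp only: mult.assoc)
  then show "zvar ^ l * in_z ?H * (zvar_inv ^ k * ((-1) ^ k * scalar
        (det (mat l l (\<lambda>(k', j). h_c (n j + int (if k' < k then k' else Suc k'))))))) =
      in_z (Abs_fps (\<lambda>i. h_c (int i + int k - int l))) * scalar ((-1) ^ k *
        det (mat l l (\<lambda>(k', j). h_c (n j + int (if k' < k then k' else Suc k')))))"
    by (simp only: z scalar_simps)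
qed simp

text \<open>
  \<open>\<s>(w) w\<^sup>-\<^sup>m(c)\<close> is the value of \<open>\<s>(w) \<partial>(w\<^sup>-\<^sup>1)\<close> at \<open>X\<^sup>m(c)\<close>, since \<open>\<partial>(w\<^sup>-\<^sup>1)\<close> substitutes \<open>w\<^sup>-\<^sup>1\<close> for
  \<open>X\<close>.
\<close>

lemma in_w_s_mult_w_inv_c:
  obtains g where "in_w s_series * w_inv_c m = fls_const (g :: ('n::finite, 'r::finite) Br fls)"
    and "\<And>j. fls_nth g (- j) = base (partial_s j (Xc m))"
proof -
  define p where "p = (\<Sum>i\<le>m. fls_const (base (coeff (Xc m) i)) * fls_X_inv ^ i :: ('n, 'r) Br fls)"
  define g where "g = fps_to_fls s_series * p"
  have deg: "degree (Xc m :: 'n B0 poly) \<le> m"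
    by (rule degree_le) (simp add: coeff_Xc)
  let ?f = "\<lambda>a. scalar (base a :: ('n, 'r) Br)"
  have f0: "?f 0 = 0" by (simp add: base_simps scalar_simps)
  have degf: "degree (map_poly ?f (Xc m)) \<le> m"
    using map_poly_degree_leq[of ?f "Xc m"] deg by linarith
  have "w_inv_c m = (\<Sum>i\<le>degree (map_poly ?f (Xc m)). ?f (coeff (Xc m) i) * wvar_inv ^ i)"
    unfolding w_inv_c_def poly_altdef by (simp add: coeff_map_poly f0)
  also have "\<dots> = (\<Sum>i\<le>m. ?f (coeff (Xc m) i) * wvar_inv ^ i)"
  proof (rule sum.mono_neutral_left)
    show "\<forall>i\<in>{..m} - {..degree (map_poly ?f (Xc m))}. ?f (coeff (Xc m) i) * wvar_inv ^ i = 0"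
      using coeff_eq_0[of "map_poly ?f (Xc m)"] by (auto simp: coeff_map_poly f0)
  qed (use degf in auto)
  also have "\<dots> = fls_const p"
    by (simp add: p_def fls_const_sum scalar_def wvar_inv_def fls_const_power flip: fls_const_mult_const)
  finally have 1: "in_w s_series * w_inv_c m = fls_const g"
    by (simp add: g_def in_w_def)
  have "fls_nth g (- j) = base (partial_s j (Xc m))" for j
  proof -
    have "fls_nth g (- j) = (\<Sum>i\<le>m. fls_nth (fls_const (base (coeff (Xc m) i)) *
        (fps_to_fls s_series * fls_X_inv ^ i)) (- j))"
      unfolding g_def p_def sum_distrib_left fls_nth_sum
      by (simp only: mult.left_commute)
    also have "\<dots> = (\<Sum>i\<le>m. base (coeff (Xc m) i *
        (if j \<le> int i then fps_nth gen_series_inv (nat (int i - j)) else 0)))"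
      by (rule sum.cong)
        (auto simp: fls_X_inv_power_times_conv_shift s_series_def base_simps)
    finally show ?thesis by (simp add: partial_s_eq[OF deg] base_sum)
  qed
  with 1 show ?thesis by (rule that)
qed

lemma nth_in_z_w_scalar:
  fixes F :: "('n::finite, 'r::finite) Br fps"
  shows "fls_nth (fls_nth (in_z F * (in_w s_series * w_inv_c m) * scalar a) i) (- j) =
    (if i < 0 then 0 else fps_nth F (nat i) * base (partial_s j (Xc m)) * a)"
proof -
  obtain g where g: "in_w s_series * w_inv_c m = fls_const (g :: ('n, 'r) Br fls)"
    "\<And>j. fls_nth g (- j) = base (partial_s j (Xc m))" using in_w_s_mult_w_inv_c by blast
  show ?thesis unfolding g(1) by (simp add: in_z_def scalar_def g(2))
qed

theorem corollary3p19:
  fixes lam :: "nat list" and i j :: int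
  assumes "is_partition CARD('r::finite) lam"
  shows "(if i < 0 then 0 else star (Xc (nat i)) (partial_s j) (Delta lam)) =
    fls_nth (fls_nth
      (zvar ^ (CARD('r) - 1) * wvar_inv ^ (CARD('r) - 1) * (in_z c_series * in_w s_series) *
        in_z gen_series_inv * Delta_wz lam :: ('n::finite, 'r) Br fls fls) i) (- j)"
proof -
  let ?r = "CARD('r)"
  obtain l where l: "?r = Suc l" using not0_implies_Suc[of ?r] by auto
  define m where "m q = ?r - 1 - q + lam ! q" for q
  define n where "n q j' = (let jj = if j' < q then j' else Suc j' in int (lam ! jj) - int jj)" for q j'
  define N :: "nat \<Rightarrow> nat \<Rightarrow> ('n, 'r) Br" where
    "N q k = det (mat l l (\<lambda>(k', j'). h_c (n q j' + int (if k' < k then k' else Suc k'))))" for q k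
  let ?H = "c_series * gen_series_inv :: ('n, 'r) Br fps"
  let ?D = "mat ?r ?r (\<lambda>(k, j). if k = 0 then w_inv_c (?r - 1 - j + lam ! j)
     else sigma_bar_h (int (lam ! j) - int j + int k)) :: ('n, 'r) Br fls fls mat"
  let ?h = "\<lambda>k. Abs_fps (\<lambda>i. h_c (int i + int k - int l)) :: ('n, 'r) Br fps"
  have w1: "wvar_inv ^ l * wvar ^ l = (1 :: ('n, 'r) Br fls fls)"
    by (simp add: wvar_def wvar_inv_def fls_X_inv_times_conv_shift flip: power_mult_distrib)
  \<comment> \<open>\<open>n q\<close> runs through the numbers \<open>\<lambda>\<^sub>j - j\<close> with \<open>j\<close> different from \<open>q\<close>; the removed first row
      accounts for the summand \<open>1\<close>\<close>
  have minor: "mat_delete ?D 0 q = mat l l (\<lambda>(k', j'). sigma_bar_h (n q j' + int k' + 1))"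
    if "q < Suc l" for q
    using that l by (intro eq_matI) (auto simp: mat_delete_def n_def Let_def algebra_simps)
  have "zvar ^ (?r - 1) * wvar_inv ^ (?r - 1) * (in_z c_series * in_w s_series) *
        in_z gen_series_inv * Delta_wz lam =
      (wvar_inv ^ l * wvar ^ l) * (zvar ^ l * in_z ?H * in_w s_series * det ?D)"
    by (simp only: l diff_Suc_1 in_z_mult Delta_wz_def mult_ac)
  also have "\<dots> = zvar ^ l * in_z ?H * in_w s_series * det ?D"
    by (simp only: w1 mult_1_left)
  also have "det ?D = (\<Sum>q<Suc l. w_inv_c (m q) * ((-1) ^ q * det (mat_delete ?D 0 q)))"
    using l by (subst laplace_expansion_row[of _ ?r 0]) (auto simp: cofactor_def m_def)
  also have "zvar ^ l * in_z ?H * in_w s_series * \<dots> =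
      (\<Sum>q<Suc l. (in_w s_series * w_inv_c (m q)) * ((-1) ^ q *
        (zvar ^ l * in_z ?H * det (mat_delete ?D 0 q))))"
    unfolding sum_distrib_left by (intro sum.cong refl) (simp only: mult_ac)
  also have "\<dots> = (\<Sum>q<Suc l. (in_w s_series * w_inv_c (m q)) * ((-1) ^ q *
        (\<Sum>k<Suc l. in_z (?h k) * scalar ((-1) ^ k * N q k))))"
    by (intro sum.cong refl) (simp only: lessThan_iff minor zvar_in_z_det_sigma_bar_h N_def)
  also have "\<dots> = (\<Sum>q<Suc l. \<Sum>k<Suc l. in_z (?h k) * (in_w s_series * w_inv_c (m q)) *
      scalar ((-1) ^ q * ((-1) ^ k * N q k)))"
    unfolding sum_distrib_left by (intro sum.cong refl) (simp add: scalar_simps mult_ac)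
  finally have rhs: "fls_nth (fls_nth (zvar ^ (?r - 1) * wvar_inv ^ (?r - 1) *
        (in_z c_series * in_w s_series) * in_z gen_series_inv * Delta_wz lam) i) (- j) =
      (\<Sum>q<Suc l. \<Sum>k<Suc l. if i < 0 then 0 else fps_nth (?h k) (nat i) *
        base (partial_s j (Xc (m q))) * ((-1) ^ q * ((-1) ^ k * N q k)))"
    by (simp only: fls_nth_sum nth_in_z_w_scalar)
  show ?thesis
  proof (cases "i < 0")
    case True
    then show ?thesis unfolding rhs by simp
  next
    case False
    have "star (Xc (nat i)) (partial_s j) (Delta lam) =
        (\<Sum>q<?r. (-1) ^ q * base (partial_s j (Xc (m q))) *
          (\<Sum>k<?r. (-1) ^ k * h_c (int (nat i) + int k + 1 - int ?r) *
            det (mat (?r - 1) (?r - 1) (\<lambda>(k', j).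
              h_c (int (m (if j < q then j else Suc j)) + int (if k' < k then k' else Suc k') + 1 - int ?r)
              :: ('n, 'r) Br))))"
      unfolding m_def using assms by (rule star_Xc_eq[OF partial_s_linear])
    also have "\<dots> = (\<Sum>q<Suc l. (-1) ^ q * base (partial_s j (Xc (m q))) *
        (\<Sum>k<Suc l. (-1) ^ k * h_c (int (nat i) + int k - int l) * N q k))"
      unfolding l N_def
    proof (intro sum.cong refl arg_cong2[where f = "(*)"] arg_cong[of _ _ det] eq_matI)
      fix q k k' j' assume "k' < dim_row (mat l l (\<lambda>(k', j'). h_c (n q j' + int (if k' < k then k' else Suc k'))))"
        "j' < dim_col (mat l l (\<lambda>(k', j'). h_c (n q j' + int (if k' < k then k' else Suc k'))))"
      then show "mat (Suc l - 1) (Suc l - 1) (\<lambda>(k', j).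
            h_c (int (m (if j < q then j else Suc j)) + int (if k' < k then k' else Suc k') + 1 - int (Suc l))
            :: ('n, 'r) Br) $$ (k', j') =
          mat l l (\<lambda>(k', j'). h_c (n q j' + int (if k' < k then k' else Suc k'))) $$ (k', j')"
        by (auto simp: m_def n_def l of_nat_diff intro!: arg_cong[of _ _ h_c])
    qed (auto simp: algebra_simps)
    finally show ?thesis
      unfolding rhs using False
      by (simp add: sum_distrib_left mult_ac del: sum.lessThan_Suc)
  qed
qed

end
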